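(* Let $1\le p<\infty$ with $q$ the conjugate exponent ($1/p+1/q=1$, $q=\infty$ if $p=1$). Let $f\in L^p(\mathbb{R})$. Suppose $g:\mathbb{R}\to\mathbb{R}$ is of bounded variation with limit $0$ at $\pm\infty$ such that $\int_{-\infty}^\infty|s|^{1/p}\,|dg(s)|<\infty$. Then $\hat g\in L^q(\mathbb{R})$ and $$\int_{-\infty}^\infty\hat f g=\int_{-\infty}^\infty f(s)\hat g(s)\,ds.$$ Moreover, $$\left|\int_{-\infty}^\infty\hat f g\right|\le C_q\|f\|_p\int_{-\infty}^\infty|s|^{1/p}\,|dg(s)|,$$ where $C_q=4^{1/q}\left(\int_0^\infty\left|\frac{\sin t}{t}\right|^q dt\right)^{1/q}$ for $1<q<\infty$ and $C_\infty=1$.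
   Context: $L^p(\mathbb{R})$ consists of complex-valued functions. For $f\in L^p(\mathbb{R})$, $1\le p<\infty$, let $\Psi_f(s)=\int_{-\infty}^\infty\left(\frac{1-e^{-ist}}{it}\right)f(t)\,dt$ (kernel equal to $s$ at $t=0$), a continuous function with $|\Psi_f(s)|\le C_q\|f\|_p|s|^{1/p}$. The Fourier transform of $f$ is the distributional derivative $\hat f=\Psi_f'$, and for $g$ of bounded variation on $\mathbb{R}$ with $g(x)=o(|x|^{-1/p})$ as $|x|\to\infty$ (if $p=1$, $g(x)=O(|x|^{-1})$ suffices) the integral on the left (no variable or measure displayed) is defined by $$\int_{-\infty}^\infty\hat f g:=-\int_{-\infty}^\infty\Psi_f(s)\,dg(s).$$ The last integral is a Henstock–Stieltjes integral; in the situation here it equals the Lebesgue–Stieltjes integral with respect to the finite signed Borel measure $\mu$ with $\mu((a,b])=g(b+)-g(a+)$. (The growth condition on $g$ follows from the hypotheses of the theorem.) $\int\varphi\,|dg|$ is the integral of $\varphi$ with respect to the variation function $V_g(s)=$ total variation of $g$ on $(-\infty,s]$. The Fourier transform of $g$ is $\hat g(t)=\int_{-\infty}^\infty e^{-ist}g(s)\,ds$, understood as an improper integral for $t\ne0$ (it coincides with the Lebesgue integral if $g\in L^1(\mathbb{R})$). *)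

theory Defs
  imports "HOL-Analysis.Analysis" "HOL-Library.Landau_Symbols"
begin

definition in_Lp :: "ennreal \<Rightarrow> (real \<Rightarrow> complex) \<Rightarrow> bool" where
  "in_Lp r h \<longleftrightarrow> h \<in> borel_measurable lebesgue \<and>
     (if r = \<infinity> then (\<exists>C. AE x in lebesgue. norm (h x) \<le> C)
      else integrable lebesgue (\<lambda>x. norm (h x) powr enn2real r))"

definition Lp_norm :: "real \<Rightarrow> (real \<Rightarrow> complex) \<Rightarrow> real" where
  "Lp_norm p h = (LINT x|lebesgue. norm (h x) powr p) powr (1 / p)"

definition Psi :: "(real \<Rightarrow> complex) \<Rightarrow> real \<Rightarrow> complex" where
  "Psi f s = (LINT t|lebesgue.
     (if t = 0 then of_real s
      else (1 - exp (- \<i> * of_real s * of_real t)) / (\<i> * of_real t)) * f t)"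

definition variation_sums :: "(real \<Rightarrow> real) \<Rightarrow> real set \<Rightarrow> real set" where
  "variation_sums g S =
     {(\<Sum>i<n. \<bar>g (x (Suc i)) - g (x i)\<bar>) | (x :: nat \<Rightarrow> real) n.
        (\<forall>i<n. x i \<le> x (Suc i)) \<and> (\<forall>i\<le>n. x i \<in> S)}"

definition bounded_variation_on :: "(real \<Rightarrow> real) \<Rightarrow> real set \<Rightarrow> bool" where
  "bounded_variation_on g S \<longleftrightarrow> bdd_above (variation_sums g S)"

definition variation_function :: "(real \<Rightarrow> real) \<Rightarrow> real \<Rightarrow> real" where
  "variation_function g s = Sup (variation_sums g {..s})"

text \<open>The measure \<open>|dg|\<close>. The variation function need not be right-continuous; its
  Lebesgue-Stieltjes measure gives \<open>{a<..b}\<close> the mass \<open>V (b+) - V (a+)\<close>.\<close>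

definition variation_measure :: "(real \<Rightarrow> real) \<Rightarrow> real measure" where
  "variation_measure g = interval_measure (\<lambda>s. Lim (at_right s) (variation_function g))"

text \<open>The Henstock-Stieltjes integral of \<open>F\<close> with respect to \<open>g\<close> over the whole line. A gauge on
  \<open>[-\<infinity>, \<infinity>]\<close> amounts to a gauge on the real line together with neighbourhoods
  \<open>[-\<infinity>, -R)\<close> and \<open>(R, \<infinity>]\<close> of the two infinite points. In a fine tagged division the two
  unbounded intervals are tagged at \<open>\<plusminus>\<infinity>\<close>, where the integrand is taken to be \<open>0\<close>, so only
  the division of the bounded part \<open>[a, b]\<close> contributes to the sum.\<close>

definition has_HS_integral :: "(real \<Rightarrow> complex) \<Rightarrow> (real \<Rightarrow> real) \<Rightarrow> complex \<Rightarrow> bool" where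
  "has_HS_integral F g I \<longleftrightarrow>
     (\<forall>e>0. \<exists>\<gamma> R. gauge \<gamma> \<and> R > 0 \<and>
        (\<forall>a b \<D>. a < - R \<and> R < b \<and> \<D> tagged_division_of {a..b} \<and> \<gamma> fine \<D> \<longrightarrow>
           norm ((\<Sum>(x, K)\<in>\<D>. (g (Sup K) - g (Inf K)) *\<^sub>R F x) - I) < e))"

definition HS_integral :: "(real \<Rightarrow> complex) \<Rightarrow> (real \<Rightarrow> real) \<Rightarrow> complex" where
  "HS_integral F g = (THE I. has_HS_integral F g I)"

text \<open>The integral of the product of the distribution \<open>\<Psi>\<^sub>f'\<close> (the Fourier transform of
  \<open>f\<close>) with \<open>g\<close>, and the conditions on \<open>g\<close> under which it is defined.\<close>

definition fourier_pairing_defined :: "real \<Rightarrow> (real \<Rightarrow> complex) \<Rightarrow> (real \<Rightarrow> real) \<Rightarrow> bool" where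
  "fourier_pairing_defined p f g \<longleftrightarrow>
     bounded_variation_on g UNIV \<and>
     (g \<in> o[at_infinity](\<lambda>x. \<bar>x\<bar> powr (- 1 / p)) \<or>
      p = 1 \<and> g \<in> O[at_infinity](\<lambda>x. \<bar>x\<bar> powr (- 1))) \<and>
     (\<exists>I. has_HS_integral (Psi f) g I)"

definition fourier_pairing :: "(real \<Rightarrow> complex) \<Rightarrow> (real \<Rightarrow> real) \<Rightarrow> complex" where
  "fourier_pairing f g = - HS_integral (Psi f) g"

text \<open>Improper integral: the gauge integral over \<open>UNIV\<close> is by definition the limit of the
  integrals over \<open>[a, b]\<close> as \<open>a \<rightarrow> -\<infinity>\<close> and \<open>b \<rightarrow> \<infinity>\<close> independently. If the integral
  does not exist, which can only happen at \<open>t = 0\<close> for the functions \<open>g\<close> of interest, the value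
  is \<open>0\<close>.\<close>

definition fourier_transform :: "(real \<Rightarrow> real) \<Rightarrow> real \<Rightarrow> complex" where
  "fourier_transform g t = integral UNIV (\<lambda>s. exp (- \<i> * of_real s * of_real t) * of_real (g s))"

definition C_const :: "ennreal \<Rightarrow> real" where
  "C_const q =
     (if q = \<infinity> then 1
      else 4 powr (1 / enn2real q) *
        (LINT t:{0<..}|lebesgue. \<bar>sin t / t\<bar> powr enn2real q) powr (1 / enn2real q))"

end

theory Submission
  imports Defs
begin

text \<open>Write \<open>k\<^sub>t(s) = (1 - e^(-ist)) / (it)\<close>, so that \<open>\<Psi>\<^sub>f(s)\<close> is the integral of \<open>k\<^sub>t(s) f(t) dt\<close> and
  \<open>k\<^sub>t\<close> has derivative \<open>e^(-ist)\<close> in \<open>s\<close>. No signed measure is needed: for a primitive \<open>k\<close> of a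
  bounded function \<open>k'\<close>, the Stieltjes integral of \<open>k\<close> over \<open>[a, b]\<close> is replaced by
  \<open>k(b) g(b) - k(a) g(a) - \<integral> k' g\<close>, and subdividing \<open>[a, b]\<close> bounds this expression by
  \<open>\<integral> |k| |dg|\<close> (exactly if \<open>g(a+)\<close>, \<open>g(b+)\<close> replace \<open>g(a)\<close>, \<open>g(b)\<close>, and up to a constant
  factor otherwise). With \<open>k = k\<^sub>t\<close> it yields the convergence of the improper integral, the limit
  \<open>-g^(t)\<close> and \<open>|g^(t)| \<le> \<integral> |k\<^sub>t| |dg|\<close>; with \<open>k = k\<^sub>t - k\<^sub>t(x)\<close> on the cell tagged by \<open>x\<close> it
  compares a Henstock-Stieltjes sum of \<open>k\<^sub>t\<close> with \<open>-g^(t)\<close>. Multiplication by \<open>f\<close>,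
  integration in \<open>t\<close>, Tonelli's theorem and Hoelder's inequality in the form
  \<open>\<integral> |f(t)| |k\<^sub>t(x) - k\<^sub>t(y)| dt \<le> C\<^sub>q \<parallel>f\<parallel>\<^sub>p |x - y| powr (1/p)\<close> then give all claims, with a gauge
  of constant radius.\<close>

section \<open>Functions of bounded variation\<close>

lemma variation_sums_nonempty: "variation_sums g {..s} \<noteq> {}"
proof -
  have "(\<Sum>i<(0::nat). \<bar>g ((\<lambda>_. s) (Suc i)) - g ((\<lambda>_. s) i)\<bar>) \<in> variation_sums g {..s}"
    unfolding variation_sums_def by (rule CollectI, rule exI[of _ "\<lambda>_. s"], rule exI[of _ 0]) auto
  then show ?thesis by blast
qed

lemma variation_sums_mono: "S \<subseteq> T \<Longrightarrow> variation_sums g S \<subseteq> variation_sums g T"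
  unfolding variation_sums_def by blast

text \<open>The partition behind \<open>v\<close> is prolonged by the two points \<open>a\<close>
  and \<open>b\<close>. The new step from its last point to \<open>a\<close> only adds a nonnegative
  term, hence the inequality.\<close>

lemma variation_sums_extend:
  assumes "v \<in> variation_sums g {..a}" "a \<le> b"
  shows "\<exists>w \<in> variation_sums g {..b}. v + \<bar>g b - g a\<bar> \<le> w"
proof -
  from assms(1) obtain x and n :: nat where
    v: "v = (\<Sum>i<n. \<bar>g (x (Suc i)) - g (x i)\<bar>)"
    and x: "\<forall>i<n. x i \<le> x (Suc i)" "\<forall>i\<le>n. x i \<le> a"
    unfolding variation_sums_def by auto
  define y where "y i = (if i \<le> n then x i else if i = Suc n then a else b)" for i
  have "(\<Sum>i<n. \<bar>g (y (Suc i)) - g (y i)\<bar>) = v"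
    unfolding v by (rule sum.cong) (auto simp: y_def)
  then have "v + \<bar>g b - g a\<bar> \<le> (\<Sum>i<Suc (Suc n). \<bar>g (y (Suc i)) - g (y i)\<bar>)"
    by (simp add: y_def)
  moreover have "(\<Sum>i<Suc (Suc n). \<bar>g (y (Suc i)) - g (y i)\<bar>) \<in> variation_sums g {..b}"
    unfolding variation_sums_def
  proof (rule CollectI, rule exI[of _ y], rule exI[of _ "Suc (Suc n)"], intro conjI refl)
    have le_b: "x i \<le> b" if "i \<le> n" for i
      using x(2) that assms(2) by (meson order.trans)
    show "\<forall>i<Suc (Suc n). y i \<le> y (Suc i)"
    proof (intro allI impI)
      fix i assume "i < Suc (Suc n)"
      then consider "i < n" | "i = n" | "i = Suc n" by linarith
      then show "y i \<le> y (Suc i)"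
        using x assms(2) by cases (auto simp: y_def)
    qed
    show "\<forall>i\<le>Suc (Suc n). y i \<in> {..b}"
      using assms(2) le_b by (simp add: y_def)
  qed
  ultimately show ?thesis by blast
qed

lemma mono_at_right_limit:
  fixes V :: "real \<Rightarrow> real"
  assumes "mono V"
  shows "(V \<longlongrightarrow> Inf (V ` {x<..})) (at_right x)"
proof (rule order_tendstoI)
  have bdd: "bdd_below (V ` {x<..})"
    using assms by (intro bdd_belowI[of _ "V x"]) (auto simp: mono_def)
  fix y
  show "\<forall>\<^sub>F s in at_right x. y < V s" if "y < Inf (V ` {x<..})"
    using eventually_at_right_less[of x]
  proof eventually_elim
    case (elim s)
    have "Inf (V ` {x<..}) \<le> V s" by (rule cInf_lower) (use elim bdd in auto)
    then show ?case using that by simp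
  qed
  show "\<forall>\<^sub>F s in at_right x. V s < y" if "Inf (V ` {x<..}) < y"
  proof -
    have "V ` {x<..} \<noteq> {}" using gt_ex by auto
    then have "\<exists>w\<in>V ` {x<..}. w < y"
      using that cInf_lessD[of "V ` {x<..}" y] by blast
    then obtain z where z: "x < z" "V z < y" by auto
    show ?thesis unfolding eventually_at_right_field
    proof (intro exI[of _ z] conjI z allI impI)
      fix t assume "x < t" "t < z"
      then show "V t < y" using z monoD[OF assms, of t z] by simp
    qed
  qed
qed

section \<open>The variation function, its measure, and right limits\<close>

locale bv_function =
  fixes g :: "real \<Rightarrow> real"
  assumes bv: "bounded_variation_on g UNIV"
begin

abbreviation V :: "real \<Rightarrow> real" where "V \<equiv> variation_function g"
text \<open>The right-continuous version of \<open>V\<close>, that is, a distribution function of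
  \<open>|dg|\<close>: interval masses are increments of \<open>W\<close>, which differs from
  \<open>V\<close> where \<open>V\<close> jumps to the right.\<close>

definition W :: "real \<Rightarrow> real" where "W s = Lim (at_right s) V"
text \<open>Increments of \<open>G\<close> belong to intervals \<open>{a<..b}\<close> in the way
  those of \<open>W\<close> do, so they are dominated by the mass of the interval without any
  loss.\<close>

definition G :: "real \<Rightarrow> real" where "G s = Lim (at_right s) g"
abbreviation m :: "real measure" where "m \<equiv> variation_measure g"

lemma m_eq: "m = interval_measure W"
  unfolding variation_measure_def W_def ..

lemma sets_m [simp, measurable_cong]: "sets m = sets borel"
  and space_m [simp]: "space m = UNIV"
  by (simp_all add: m_eq)

lemma bdd_sums: "bdd_above (variation_sums g {..s})"
  using bv variation_sums_mono[of "{..s}" UNIV] unfolding bounded_variation_on_def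
  by (meson bdd_above_mono top_greatest)

text \<open>Every variation sum up to \<open>a\<close> can be prolonged to one up to
  \<open>b\<close> that gains \<open>\<bar>g b - g a\<bar>\<close>; then the supremum is taken over
  the sums up to \<open>a\<close>.\<close>

lemma abs_diff_le_V: "a \<le> b \<Longrightarrow> \<bar>g b - g a\<bar> \<le> V b - V a"
proof -
  assume ab: "a \<le> b"
  have "V a \<le> V b - \<bar>g b - g a\<bar>"
    unfolding variation_function_def
  proof (rule cSup_least[OF variation_sums_nonempty])
    fix v assume "v \<in> variation_sums g {..a}"
    then obtain w where "w \<in> variation_sums g {..b}" "v + \<bar>g b - g a\<bar> \<le> w"
      using variation_sums_extend ab by blast
    moreover from this have "w \<le> Sup (variation_sums g {..b})"
      using bdd_sums cSup_upper by blast
    ultimately show "v \<le> Sup (variation_sums g {..b}) - \<bar>g b - g a\<bar>" by simp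
  qed
  then show ?thesis by simp
qed

lemma mono_V: "mono V"
proof (rule monoI)
  fix a b :: real assume "a \<le> b"
  then show "V a \<le> V b" using abs_diff_le_V[of a b] by linarith
qed

lemma bounded_V: "\<exists>B. \<forall>s. \<bar>V s\<bar> \<le> B"
proof -
  obtain B where B: "\<And>v. v \<in> variation_sums g UNIV \<Longrightarrow> v \<le> B"
    using bv unfolding bounded_variation_on_def bdd_above_def by blast
  have nn: "0 \<le> v" if "v \<in> variation_sums g S" for v S
    using that unfolding variation_sums_def by (auto intro: sum_nonneg)
  have "V s \<le> B" for s unfolding variation_function_def
    by (rule cSup_least[OF variation_sums_nonempty])
      (use B variation_sums_mono[of "{..s}" UNIV] in blast)
  moreover have "0 \<le> V s" for s
  proof -
    obtain v where v: "v \<in> variation_sums g {..s}" using variation_sums_nonempty by blast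
    show ?thesis
      unfolding variation_function_def by (rule cSup_upper2[OF v nn[OF v] bdd_sums])
  qed
  ultimately have "\<forall>s. \<bar>V s\<bar> \<le> B" by simp
  then show ?thesis by blast
qed

lemma tendsto_W: "(V \<longlongrightarrow> W x) (at_right x)"
  using mono_at_right_limit[OF mono_V, of x] unfolding W_def
  by (simp add: tendsto_Lim)

lemma V_le_W: "V x \<le> W x"
proof (rule tendsto_lowerbound[OF tendsto_W])
  show "\<forall>\<^sub>F s in at_right x. V x \<le> V s"
    using eventually_at_right_less[of x] by eventually_elim (auto intro: monoD[OF mono_V])
qed simp

lemma W_le_V: "a < b \<Longrightarrow> W a \<le> V b"
proof (rule tendsto_upperbound[OF tendsto_W])
  assume "a < b"
  from eventually_at_right_real[OF this] have "\<forall>\<^sub>F x in at_right a. x < b"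
    by eventually_elim auto
  then show "\<forall>\<^sub>F x in at_right a. V x \<le> V b"
    by eventually_elim (auto intro: monoD[OF mono_V])
qed auto

lemma mono_W: "a \<le> b \<Longrightarrow> W a \<le> W b"
  using V_le_W[of b] W_le_V[of a b] by (cases "a = b") auto

lemma right_continuous_W: "continuous (at_right a) W"
  unfolding continuous_within
proof (rule order_tendstoI)
  fix y
  show "\<forall>\<^sub>F x in at_right a. y < W x" if "y < W a"
    using eventually_at_right_less[of a]
  proof eventually_elim
    case (elim x)
    then show ?case using mono_W[of a x] that by simp
  qed
  show "\<forall>\<^sub>F x in at_right a. W x < y" if "W a < y"
  proof -
    \<comment> \<open>One point \<open>z > a\<close> with \<open>V z < y\<close> suffices, because
      \<open>W t \<le> V z\<close> for all \<open>t < z\<close>.\<close>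
    have "\<forall>\<^sub>F x in at_right a. a < x \<and> V x < y"
      using order_tendstoD(2)[OF tendsto_W that] eventually_at_right_less by eventually_elim auto
    then obtain z where z: "a < z" "V z < y"
      using eventually_happens'[OF trivial_limit_at_right_real] by blast
    show ?thesis unfolding eventually_at_right_field
    proof (intro exI[of _ z] conjI z allI impI)
      fix t assume "a < t" "t < z"
      then show "W t < y" using z W_le_V[of t z] by simp
    qed
  qed
qed

lemma emeasure_Ioc: "a \<le> b \<Longrightarrow> emeasure m {a<..b} = ennreal (W b - W a)"
  unfolding m_eq by (rule emeasure_interval_measure_Ioc) (auto intro: mono_W right_continuous_W)

lemma bounded_W: "\<exists>B. \<forall>s. \<bar>W s\<bar> \<le> B"
proof -
  obtain B where B: "\<bar>V s\<bar> \<le> B" for s using bounded_V by blast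
  have "\<bar>W s\<bar> \<le> B" for s
    using V_le_W[of s] W_le_V[of s "s + 1"] B[of s] B[of "s + 1"] by (simp add: abs_le_iff)
  then show ?thesis by blast
qed

lemma finite_measure_m: "finite_measure m"
proof
  obtain B where B: "\<bar>W s\<bar> \<le> B" for s using bounded_W by blast
  have "emeasure m (\<Union>n. {- real n<..real n}) = (SUP n. emeasure m {- real n<..real n})"
    by (rule SUP_emeasure_incseq[symmetric]) (auto simp: incseq_def)
  also have "\<dots> \<le> ennreal (2 * B)"
  proof (rule SUP_least)
    fix n
    show "emeasure m {- real n<..real n} \<le> ennreal (2 * B)"
      using B[of "real n"] B[of "- real n"] by (subst emeasure_Ioc) (auto intro!: ennreal_leI)
  qed
  also have "(\<Union>n. {- real n<..real n}) = (UNIV :: real set)"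
  proof -
    have "x \<in> (\<Union>n. {- real n<..real n})" for x :: real
    proof -
      obtain n where "\<bar>x\<bar> < real n" using reals_Archimedean2 by blast
      then have "x \<in> {- real n<..real n}" by auto
      then show ?thesis by blast
    qed
    then show ?thesis by blast
  qed
  finally show "emeasure m (space m) \<noteq> \<infinity>" by (auto simp: top_unique)
qed

sublocale m: finite_measure m by (rule finite_measure_m)

lemma measure_Ioc: "a \<le> b \<Longrightarrow> measure m {a<..b} = W b - W a"
  using emeasure_Ioc[of a b] mono_W[of a b] by (simp add: measure_def)

text \<open>The singleton is the decreasing limit of the intervals \<open>{u - 1 / n<..u}\<close>,
  and \<open>W\<close> at their left ends is at most \<open>V u\<close>. This charges the difference
  between \<open>g u\<close> and \<open>G u\<close> to the atom at \<open>u\<close>.\<close>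

lemma jump_le_atom: "W u - V u \<le> measure m {u}"
proof -
  let ?A = "\<lambda>n. {u - 1 / real (Suc n)<..u}"
  have "(\<Inter>n. ?A n) = {u}"
  proof -
    have "x = u" if x: "\<forall>n. u - 1 / real (Suc n) < x \<and> x \<le> u" for x
    proof (rule ccontr)
      assume "x \<noteq> u"
      then have "u - x > 0" using x by force
      then obtain n where "1 / real (Suc n) < u - x"
        using nat_approx_posE by blast
      then show False using x[rule_format, of n] by linarith
    qed
    then show ?thesis by auto
  qed
  moreover have "decseq ?A"
    unfolding decseq_def
  proof (intro allI impI subsetI)
    fix i j :: nat and x assume "i \<le> j" "x \<in> ?A j"
    moreover have "1 / real (Suc j) \<le> 1 / real (Suc i)"
      using \<open>i \<le> j\<close> by (intro frac_le) auto
    ultimately show "x \<in> ?A i" unfolding greaterThanAtMost_iff by linarith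
  qed
  then have "(\<lambda>n. measure m (?A n)) \<longlonglongrightarrow> measure m (\<Inter>n. ?A n)"
    by (intro m.finite_Lim_measure_decseq) auto
  moreover have "W u - V u \<le> measure m (?A n)" for n
    using W_le_V[of "u - 1 / real (Suc n)" u] by (subst measure_Ioc) auto
  ultimately show ?thesis
    by (auto intro: LIMSEQ_le_const)
qed

lemma tendsto_G: "(g \<longlongrightarrow> G x) (at_right x)"
proof -
  \<comment> \<open>Jordan decomposition: \<open>g\<close> is the difference of the monotone
    functions \<open>V\<close> and \<open>V - g\<close>, and both have right limits.\<close>
  have "mono (\<lambda>s. V s - g s)"
  proof (rule monoI)
    fix a b :: real assume "a \<le> b"
    then show "V a - g a \<le> V b - g b" using abs_diff_le_V[of a b] by linarith
  qed
  from tendsto_diff[OF tendsto_W mono_at_right_limit[OF this]]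
  have "\<exists>l. (g \<longlongrightarrow> l) (at_right x)" by auto
  then show ?thesis unfolding G_def by (auto simp: tendsto_Lim)
qed

lemma G_minus_g: "s \<le> b \<Longrightarrow> \<bar>G b - g s\<bar> \<le> W b - V s"
proof (rule tendsto_le[OF trivial_limit_at_right_real])
  assume "s \<le> b"
  show "((\<lambda>y. V y - V s) \<longlongrightarrow> W b - V s) (at_right b)"
    by (intro tendsto_intros tendsto_W)
  show "((\<lambda>y. \<bar>g y - g s\<bar>) \<longlongrightarrow> \<bar>G b - g s\<bar>) (at_right b)"
    by (intro tendsto_intros tendsto_G)
  show "\<forall>\<^sub>F y in at_right b. \<bar>g y - g s\<bar> \<le> V y - V s"
    using \<open>s \<le> b\<close> by (intro eventually_mono[OF eventually_at_right_less[of b]] abs_diff_le_V) auto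
qed

lemma G_diff: "a \<le> b \<Longrightarrow> \<bar>G b - G a\<bar> \<le> W b - W a"
proof (cases "a = b")
  case False
  assume "a \<le> b"
  with False have ab: "a < b" by simp
  show ?thesis
  proof (rule tendsto_le[OF trivial_limit_at_right_real])
    show "((\<lambda>y. W b - V y) \<longlongrightarrow> W b - W a) (at_right a)"
      by (intro tendsto_intros tendsto_W)
    show "((\<lambda>y. \<bar>G b - g y\<bar>) \<longlongrightarrow> \<bar>G b - G a\<bar>) (at_right a)"
      by (intro tendsto_intros tendsto_G)
    have "\<forall>\<^sub>F y in at_right a. y < b"
      using eventually_at_right_real[OF ab] by eventually_elim auto
    then show "\<forall>\<^sub>F y in at_right a. \<bar>G b - g y\<bar> \<le> W b - V y"
      by eventually_elim (auto intro: G_minus_g)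
  qed
qed simp

lemma measurable_g [measurable]: "g \<in> borel_measurable borel"
proof -
  have "mono (\<lambda>s. V s - g s)"
  proof (rule monoI)
    fix a b :: real assume "a \<le> b"
    then show "V a - g a \<le> V b - g b" using abs_diff_le_V[of a b] by linarith
  qed
  then have "(\<lambda>s. V s - (V s - g s)) \<in> borel_measurable borel"
    by (intro borel_measurable_diff borel_measurable_mono mono_V)
  then show ?thesis by simp
qed

lemma bounded_g: "\<exists>B. \<forall>s. \<bar>g s\<bar> \<le> B"
proof -
  obtain B where B: "\<bar>V s\<bar> \<le> B" for s using bounded_V by blast
  have "\<bar>g s\<bar> \<le> \<bar>g 0\<bar> + 2 * B" for s
    using abs_diff_le_V[of s 0] abs_diff_le_V[of 0 s] B[of 0] B[of s]
    by (cases "s \<le> 0") linarith+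
  then show ?thesis by blast
qed

section \<open>Integration by parts as a substitute for the Stieltjes integral\<close>

lemma integrable_mult_g:
  fixes k' :: "real \<Rightarrow> complex"
  assumes "continuous_on UNIV k'" "\<And>s. norm (k' s) \<le> 1"
  shows "(\<lambda>s. k' s * of_real (g s)) integrable_on {a..b}"
proof -
  obtain B where B: "\<bar>g s\<bar> \<le> B" for s using bounded_g by blast
  have [measurable]: "k' \<in> borel_measurable borel"
    using assms(1) by (rule borel_measurable_continuous_onI)
  have "set_integrable lborel {a..b} (\<lambda>s. k' s * of_real (g s))"
    unfolding set_integrable_def
  proof (rule integrableI_bounded_set_indicator[where B = B])
    show "AE x in lborel. x \<in> {a..b} \<longrightarrow> norm (k' x * of_real (g x)) \<le> B"
    proof (intro AE_I2 impI)
      fix x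
      have "norm (k' x * of_real (g x)) \<le> 1 * \<bar>g x\<bar>"
        unfolding norm_mult norm_of_real by (intro mult_right_mono assms) simp
      then show "norm (k' x * of_real (g x)) \<le> B" using B[of x] by simp
    qed
  qed (auto simp: emeasure_lborel_Icc_eq)
  then show ?thesis by (rule set_borel_integral_eq_integral)
qed

text \<open>The function \<open>h\<close> enters only through the boundary terms and stands for
  \<open>g\<close> or \<open>G\<close>. These two differ at countably many points at most, so the
  integral can be kept with \<open>g\<close> in both cases.\<close>

definition parts_remainder ::
  "(real \<Rightarrow> complex) \<Rightarrow> (real \<Rightarrow> complex) \<Rightarrow> (real \<Rightarrow> real) \<Rightarrow> real \<Rightarrow> real \<Rightarrow> complex" where
  "parts_remainder k k' h a b =
     k b * of_real (h b) - k a * of_real (h a) - integral {a..b} (\<lambda>s. k' s * of_real (g s))"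

context
  fixes k k' :: "real \<Rightarrow> complex"
  assumes k: "\<And>s. (k has_vector_derivative k' s) (at s)"
    and cont_k': "continuous_on UNIV k'"
    and k'_le: "\<And>s. norm (k' s) \<le> 1"
begin

lemma k_diff_integral: "a \<le> b \<Longrightarrow> (k' has_integral (k b - k a)) {a..b}"
  by (intro fundamental_theorem_of_calculus) (auto intro: has_vector_derivative_at_within[OF k])

lemma k_lipschitz: "norm (k x - k y) \<le> \<bar>x - y\<bar>"
proof -
  have *: "norm (k b - k a) \<le> b - a" if "a \<le> b" for a b
    using has_integral_bound_real[OF _ _ k_diff_integral[OF that], of 1 "{}"] k'_le that by simp
  show ?thesis using *[of x y] *[of y x] by (cases "x \<le> y") (auto simp: norm_minus_commute)
qed

lemma measurable_k [measurable]: "k \<in> borel_measurable borel"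
  by (intro borel_measurable_continuous_onI continuous_at_imp_continuous_on ballI
      has_vector_derivative_continuous[OF k])

lemma parts_remainder_add:
  assumes "a \<le> b" "b \<le> c"
  shows "parts_remainder k k' h a c = parts_remainder k k' h a b + parts_remainder k k' h b c"
  using Henstock_Kurzweil_Integration.integral_combine[OF assms integrable_mult_g[OF cont_k' k'_le]]
  by (simp add: parts_remainder_def algebra_simps)

text \<open>The remainder equals the integral of \<open>k' (G b - g)\<close> plus
  \<open>k a (G b - G a)\<close>. Both differences of values are at most \<open>W b - W a\<close>,
  and the Lipschitz bound replaces \<open>k a\<close> by \<open>k y\<close> under the integral; each
  of the two costs \<open>b - a\<close> times the mass.\<close>

lemma parts_remainder_piece:
  assumes ab: "a \<le> b"
  shows "ennreal (norm (parts_remainder k k' G a b))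
    \<le> (\<integral>\<^sup>+ y. ennreal (norm (k y)) * indicator {a<..b} y \<partial>m) + ennreal (2 * (b - a) * (W b - W a))"
proof -
  let ?\<Delta> = "W b - W a"
  have \<Delta>: "0 \<le> ?\<Delta>" using mono_W[OF ab] by simp
  have int: "((\<lambda>s. k' s * of_real (g s)) has_integral integral {a..b} (\<lambda>s. k' s * of_real (g s))) {a..b}"
    by (rule integrable_integral[OF integrable_mult_g[OF cont_k' k'_le]])
  have "((\<lambda>s. k' s * of_real (G b) - k' s * of_real (g s)) has_integral
      ((k b - k a) * of_real (G b) - integral {a..b} (\<lambda>s. k' s * of_real (g s)))) {a..b}"
    by (intro has_integral_diff int has_integral_mult_left k_diff_integral ab)
  then have "((\<lambda>s. k' s * of_real (G b - g s)) has_integral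
      ((k b - k a) * of_real (G b) - integral {a..b} (\<lambda>s. k' s * of_real (g s)))) {a..b}"
    by (simp add: algebra_simps)
  then have 1: "norm ((k b - k a) * of_real (G b) - integral {a..b} (\<lambda>s. k' s * of_real (g s)))
      \<le> ?\<Delta> * measure lborel {a..b}"
  proof (rule has_integral_bound_real[OF \<Delta>, of "{a}", rotated])
    \<comment> \<open>The point \<open>a\<close> is excepted, since an atom there may make
      \<open>\<bar>G b - g a\<bar>\<close> larger than the mass of \<open>{a<..b}\<close>.\<close>
    fix s assume s: "s \<in> {a..b} - {a}"
    then have "\<bar>G b - g s\<bar> \<le> ?\<Delta>"
      using G_minus_g[of s b] W_le_V[of a s] by auto
    moreover have "norm (k' s * of_real (G b - g s)) \<le> 1 * \<bar>G b - g s\<bar>"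
      unfolding norm_mult norm_of_real by (intro mult_right_mono k'_le) simp
    ultimately show "norm (k' s * of_real (G b - g s)) \<le> ?\<Delta>" by simp
  qed simp
  have "parts_remainder k k' G a b = ((k b - k a) * of_real (G b)
      - integral {a..b} (\<lambda>s. k' s * of_real (g s))) + k a * of_real (G b - G a)"
    by (simp add: parts_remainder_def algebra_simps)
  then have "norm (parts_remainder k k' G a b) \<le> ?\<Delta> * (b - a) + norm (k a) * ?\<Delta>"
    using add_mono[OF 1 mult_left_mono[OF G_diff[OF ab] norm_ge_zero[of "k a"]]] ab
    by (auto simp: norm_mult simp flip: of_real_diff intro: norm_triangle_le)
  then have "ennreal (norm (parts_remainder k k' G a b)) \<le> ennreal ((norm (k a) + (b - a)) * ?\<Delta>)"
    by (intro ennreal_leI) (simp add: algebra_simps)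
  also have "\<dots> = (\<integral>\<^sup>+ y. ennreal (norm (k a) + (b - a)) * indicator {a<..b} y \<partial>m)"
    using ab by (subst nn_integral_cmult_indicator) (auto simp: emeasure_Ioc ennreal_mult')
  also have "\<dots> \<le> (\<integral>\<^sup>+ y. ennreal (norm (k y)) * indicator {a<..b} y
      + ennreal (2 * (b - a)) * indicator {a<..b} y \<partial>m)"
  proof (rule nn_integral_mono)
    fix y
    show "ennreal (norm (k a) + (b - a)) * indicator {a<..b} y \<le>
      ennreal (norm (k y)) * indicator {a<..b} y + ennreal (2 * (b - a)) * indicator {a<..b} y"
    proof (cases "y \<in> {a<..b}")
      case True
      have "norm (k a) \<le> norm (k y) + norm (k a - k y)"
        by (metis add.commute diff_add_cancel norm_triangle_ineq)
      then have "norm (k a) + (b - a) \<le> norm (k y) + 2 * (b - a)"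
        using k_lipschitz[of a y] True by auto
      then show ?thesis using True ab by (simp add: ennreal_plus[symmetric] del: ennreal_plus)
    qed simp
  qed
  also have "\<dots> = (\<integral>\<^sup>+ y. ennreal (norm (k y)) * indicator {a<..b} y \<partial>m)
      + (\<integral>\<^sup>+ y. ennreal (2 * (b - a)) * indicator {a<..b} y \<partial>m)"
    by (intro nn_integral_add) auto
  also have "(\<integral>\<^sup>+ y. ennreal (2 * (b - a)) * indicator {a<..b} y \<partial>m) = ennreal (2 * (b - a) * ?\<Delta>)"
    using ab by (subst nn_integral_cmult_indicator) (auto simp: emeasure_Ioc ennreal_mult')
  finally show ?thesis .
qed

lemma nn_integral_Ioc_add:
  assumes "a \<le> b" "b \<le> c"
  shows "(\<integral>\<^sup>+ y. ennreal (norm (k y)) * indicator {a<..b} y \<partial>m)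
    + (\<integral>\<^sup>+ y. ennreal (norm (k y)) * indicator {b<..c} y \<partial>m)
    = (\<integral>\<^sup>+ y. ennreal (norm (k y)) * indicator {a<..c} y \<partial>m)"
  using assms
  by (subst nn_integral_add[symmetric]) (auto intro!: nn_integral_cong split: split_indicator)

text \<open>With \<open>n\<close> pieces of length \<open>h\<close> the errors are
  \<open>2 * h\<close> times increments of \<open>W\<close>. They telescope, so the total error is
  proportional to \<open>h\<close> whatever \<open>n\<close> is.\<close>

lemma parts_remainder_subdivided:
  assumes "0 \<le> h"
  shows "ennreal (norm (parts_remainder k k' G a (a + real n * h)))
    \<le> (\<integral>\<^sup>+ y. ennreal (norm (k y)) * indicator {a<..a + real n * h} y \<partial>m)
      + ennreal (2 * h * (W (a + real n * h) - W a))"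
proof (induction n)
  case 0
  then show ?case by (simp add: parts_remainder_def)
next
  case (Suc n)
  define b where "b = a + real n * h"
  have c: "a + real (Suc n) * h = b + h" by (simp add: b_def algebra_simps)
  have ab: "a \<le> b" "b \<le> b + h" using assms by (simp_all add: b_def)
  have "ennreal (norm (parts_remainder k k' G a (b + h)))
      \<le> ennreal (norm (parts_remainder k k' G a b)) + ennreal (norm (parts_remainder k k' G b (b + h)))"
    unfolding parts_remainder_add[OF ab]
    by (simp add: ennreal_plus[symmetric] norm_triangle_ineq del: ennreal_plus)
  also have "\<dots> \<le> ((\<integral>\<^sup>+ y. ennreal (norm (k y)) * indicator {a<..b} y \<partial>m) + ennreal (2 * h * (W b - W a)))
    + ((\<integral>\<^sup>+ y. ennreal (norm (k y)) * indicator {b<..b + h} y \<partial>m) + ennreal (2 * h * (W (b + h) - W b)))"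
    using parts_remainder_piece[OF ab(2)] Suc.IH by (intro add_mono) (auto simp: b_def)
  also have "\<dots> = ((\<integral>\<^sup>+ y. ennreal (norm (k y)) * indicator {a<..b} y \<partial>m)
      + (\<integral>\<^sup>+ y. ennreal (norm (k y)) * indicator {b<..b + h} y \<partial>m))
      + (ennreal (2 * h * (W b - W a)) + ennreal (2 * h * (W (b + h) - W b)))"
    by (simp add: ac_simps)
  also have "ennreal (2 * h * (W b - W a)) + ennreal (2 * h * (W (b + h) - W b))
      = ennreal (2 * h * (W (b + h) - W a))"
    using mono_W[OF ab(1)] mono_W[OF ab(2)] assms
    by (subst ennreal_plus[symmetric]) (auto simp: algebra_simps intro!: mult_left_mono)
  finally show ?case unfolding c nn_integral_Ioc_add[OF ab] .
qed

lemma parts_remainder_right_limit_le: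
  assumes ab: "a \<le> b"
  shows "ennreal (norm (parts_remainder k k' G a b))
    \<le> (\<integral>\<^sup>+ y. ennreal (norm (k y)) * indicator {a<..b} y \<partial>m)"
proof (rule ennreal_le_epsilon)
  fix e :: real assume e: "0 < e"
  \<comment> \<open>\<open>C\<close> is the error for a single piece; \<open>n\<close> equal pieces
    reduce it to \<open>C / n\<close>.\<close>
  define C where "C = 2 * (b - a) * (W b - W a)"
  obtain n where n: "C / e < real n" using reals_Archimedean2 by blast
  have C: "0 \<le> C" using ab mono_W[OF ab] by (simp add: C_def)
  then have n0: "real n > 0" using n e by (smt (verit) divide_nonneg_pos)
  have "a + real n * ((b - a) / real n) = b" using n0 by simp
  moreover have "2 * ((b - a) / real n) * (W b - W a) \<le> e"
    using n n0 e by (simp add: C_def field_simps)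
  moreover note parts_remainder_subdivided[of "(b - a) / real n" a n]
  ultimately show "ennreal (norm (parts_remainder k k' G a b))
      \<le> (\<integral>\<^sup>+ y. ennreal (norm (k y)) * indicator {a<..b} y \<partial>m) + ennreal e"
    using ab n0 by (auto intro: order_trans add_left_mono ennreal_leI)
qed

text \<open>Passing from \<open>G\<close> to \<open>g\<close> changes the boundary terms by
  \<open>k x * (G x - g x)\<close> at the two ends, and each change is at most the contribution of
  an atom. The atom at \<open>b\<close> lies in \<open>{a<..b}\<close> and the one at
  \<open>a\<close> in \<open>{a..<b}\<close>, which is why both half-open intervals occur.\<close>

lemma parts_remainder_le:
  assumes ab: "a \<le> b"
  shows "ennreal (norm (parts_remainder k k' g a b))
    \<le> 2 * ((\<integral>\<^sup>+ y. ennreal (norm (k y)) * indicator {a<..b} y \<partial>m)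
        + (\<integral>\<^sup>+ y. ennreal (norm (k y)) * indicator {a..<b} y \<partial>m))"
    (is "_ \<le> 2 * (?R + ?L)")
\<comment> \<open>If \<open>a = b\<close>, both half-open intervals are empty and cannot absorb an
  atom, but the remainder vanishes.\<close>
proof (cases "a = b")
  case True
  then show ?thesis by (simp add: parts_remainder_def)
next
  case False
  with ab have ab': "a < b" by simp
  have atom: "ennreal (norm (k x * of_real (G x - g x)))
      \<le> (\<integral>\<^sup>+ y. ennreal (norm (k y)) * indicator A y \<partial>m)" if "x \<in> A" "A \<in> sets borel" for x A
  proof -
    have "norm (k x * of_real (G x - g x)) \<le> norm (k x) * measure m {x}"
      unfolding norm_mult norm_of_real
      using G_minus_g[of x x] jump_le_atom[of x] by (intro mult_left_mono) auto
    then have "ennreal (norm (k x * of_real (G x - g x))) \<le> ennreal (norm (k x)) * emeasure m {x}"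
      by (simp add: m.emeasure_eq_measure ennreal_mult[symmetric] ennreal_leI)
    also have "\<dots> = (\<integral>\<^sup>+ y. ennreal (norm (k x)) * indicator {x} y \<partial>m)"
      by (subst nn_integral_cmult_indicator) auto
    also have "\<dots> \<le> (\<integral>\<^sup>+ y. ennreal (norm (k y)) * indicator A y \<partial>m)"
      using that by (intro nn_integral_mono) (auto split: split_indicator)
    finally show ?thesis .
  qed
  have "parts_remainder k k' g a b = parts_remainder k k' G a b
      - k b * of_real (G b - g b) + k a * of_real (G a - g a)"
    by (simp add: parts_remainder_def algebra_simps)
  then have "norm (parts_remainder k k' g a b) \<le> norm (parts_remainder k k' G a b)
      + norm (k b * of_real (G b - g b)) + norm (k a * of_real (G a - g a))"
    using norm_triangle_ineq4[of "parts_remainder k k' G a b" "k b * of_real (G b - g b)"]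
      norm_triangle_ineq[of "parts_remainder k k' G a b - k b * of_real (G b - g b)"
        "k a * of_real (G a - g a)"] by simp
  then have "ennreal (norm (parts_remainder k k' g a b)) \<le> ennreal (norm (parts_remainder k k' G a b))
      + ennreal (norm (k b * of_real (G b - g b))) + ennreal (norm (k a * of_real (G a - g a)))"
    by (simp add: ennreal_plus[symmetric] ennreal_leI del: ennreal_plus)
  also have "\<dots> \<le> ?R + ?R + ?L"
    using ab' by (intro add_mono atom parts_remainder_right_limit_le) auto
  also have "\<dots> \<le> 2 * (?R + ?L)"
    unfolding mult_2 by (simp add: ac_simps)
  finally show ?thesis .
qed

end

end

section \<open>The kernel of the Fourier transform\<close>

text \<open>Young's inequality is applied to \<open>u\<close> and \<open>v\<close> divided by their
  norm bounds. This needs positive bounds; bounds that may be zero are approached from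
  above.\<close>

lemma nn_integral_Holder:
  fixes u v :: "'a \<Rightarrow> real"
  assumes pq: "p > 1" "q > 1" "1 / p + 1 / q = 1"
    and [measurable]: "u \<in> borel_measurable M" "v \<in> borel_measurable M"
    and nn: "\<And>x. 0 \<le> u x" "\<And>x. 0 \<le> v x" "0 \<le> A" "0 \<le> B"
    and u: "(\<integral>\<^sup>+ x. ennreal (u x powr p) \<partial>M) \<le> ennreal A"
    and v: "(\<integral>\<^sup>+ x. ennreal (v x powr q) \<partial>M) \<le> ennreal B"
  shows "(\<integral>\<^sup>+ x. ennreal (u x * v x) \<partial>M) \<le> ennreal (A powr (1 / p) * B powr (1 / q))"
proof -
  have pos: "(\<integral>\<^sup>+ x. ennreal (u x * v x) \<partial>M) \<le> ennreal (C powr (1 / p) * D powr (1 / q))"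
    if "A \<le> C" "0 < C" "B \<le> D" "0 < D" for C D
  proof -
    let ?c = "C powr (1 / p)" and ?d = "D powr (1 / q)"
    have cd: "0 < ?c" "0 < ?d" using that by auto
    have "(\<integral>\<^sup>+ x. ennreal (u x * v x) \<partial>M)
      \<le> (\<integral>\<^sup>+ x. ennreal (?c * ?d / (p * C)) * ennreal (u x powr p)
          + ennreal (?c * ?d / (q * D)) * ennreal (v x powr q) \<partial>M)"
    proof (rule nn_integral_mono)
      fix x
      have "(u x / ?c) * (v x / ?d) \<le> (u x / ?c) powr p / p + (v x / ?d) powr q / q"
        using nn cd pq by (intro Youngs_inequality) auto
      also have "(u x / ?c) powr p = u x powr p / C"
        using nn that pq by (simp add: powr_divide powr_powr)
      also have "(v x / ?d) powr q = v x powr q / D"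
        using nn that pq by (simp add: powr_divide powr_powr)
      finally have "(u x / ?c) * (v x / ?d) * (?c * ?d) \<le> (u x powr p / C / p + v x powr q / D / q) * (?c * ?d)"
        using cd by (intro mult_right_mono) auto
      then have "u x * v x \<le> ?c * ?d / (p * C) * (u x powr p) + ?c * ?d / (q * D) * (v x powr q)"
        using cd by (simp add: field_simps)
      then show "ennreal (u x * v x) \<le> ennreal (?c * ?d / (p * C)) * ennreal (u x powr p)
          + ennreal (?c * ?d / (q * D)) * ennreal (v x powr q)"
        using pq that nn by (simp add: ennreal_mult[symmetric] ennreal_plus[symmetric] ennreal_leI
          del: ennreal_plus)
    qed
    also have "\<dots> = ennreal (?c * ?d / (p * C)) * (\<integral>\<^sup>+ x. ennreal (u x powr p) \<partial>M)
          + ennreal (?c * ?d / (q * D)) * (\<integral>\<^sup>+ x. ennreal (v x powr q) \<partial>M)"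
      by (subst nn_integral_add) (auto simp: nn_integral_cmult)
    also have "\<dots> \<le> ennreal (?c * ?d / (p * C)) * ennreal C + ennreal (?c * ?d / (q * D)) * ennreal D"
      using u v that by (intro add_mono mult_left_mono) (auto intro: order_trans ennreal_leI)
    also have "\<dots> = ennreal (?c * ?d * (1 / p + 1 / q))"
      using pq that cd by (simp add: ennreal_mult[symmetric] ennreal_plus[symmetric] field_simps
          del: ennreal_plus)
    finally show ?thesis using pq by simp
  qed
  \<comment> \<open>The bounds \<open>A + e\<close> and \<open>B + e\<close> are positive. As
    \<open>e\<close> decreases to 0 the powers converge even at base 0, because the exponents are
    positive and the bases nonnegative.\<close>
  have "((\<lambda>e. ennreal ((A + e) powr (1 / p) * (B + e) powr (1 / q)))
      \<longlongrightarrow> ennreal ((A + 0) powr (1 / p) * (B + 0) powr (1 / q))) (at_right 0)"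
  proof (intro tendsto_ennrealI tendsto_mult tendsto_powr')
    show "((\<lambda>e. A + e) \<longlongrightarrow> A + 0) (at_right 0)" "((\<lambda>e. B + e) \<longlongrightarrow> B + 0) (at_right 0)"
      by (intro tendsto_intros; simp)+
    have "\<forall>\<^sub>F e in at_right (0::real). 0 \<le> A + e" "\<forall>\<^sub>F e in at_right (0::real). 0 \<le> B + e"
      using nn by (auto intro!: eventually_mono[OF eventually_at_right_less[of 0]])
    then show "A + 0 \<noteq> 0 \<or> 1 / p > 0 \<and> (\<forall>\<^sub>F e in at_right 0. 0 \<le> A + e)"
      "B + 0 \<noteq> 0 \<or> 1 / q > 0 \<and> (\<forall>\<^sub>F e in at_right 0. 0 \<le> B + e)"
      using pq by auto
  qed auto
  moreover have "\<forall>\<^sub>F e in at_right 0. (\<integral>\<^sup>+ x. ennreal (u x * v x) \<partial>M)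
      \<le> ennreal ((A + e) powr (1 / p) * (B + e) powr (1 / q))"
    using eventually_at_right_less[of 0] by eventually_elim (use nn in \<open>auto intro!: pos\<close>)
  ultimately show ?thesis
    using tendsto_lowerbound[OF _ _ trivial_limit_at_right_real] by fastforce
qed

section \<open>The kernel of \<open>Psi\<close>: derivative, modulus and pointwise bounds\<close>

definition fourier_kernel :: "real \<Rightarrow> real \<Rightarrow> complex" where
  "fourier_kernel t s = (if t = 0 then of_real s
      else (1 - exp (- \<i> * of_real s * of_real t)) / (\<i> * of_real t))"

lemma fourier_kernel_0 [simp]: "fourier_kernel t 0 = 0"
  by (simp add: fourier_kernel_def)

lemma fourier_kernel_measurable [measurable]:
  "(\<lambda>(t, s). fourier_kernel t s) \<in> borel_measurable (borel \<Otimes>\<^sub>M borel)"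
  unfolding fourier_kernel_def by measurable

lemma fourier_kernel_measurable1 [measurable]: "(\<lambda>t. fourier_kernel t s) \<in> borel_measurable borel"
  and fourier_kernel_measurable2 [measurable]: "fourier_kernel t \<in> borel_measurable borel"
  unfolding fourier_kernel_def by measurable

lemma has_vector_derivative_fourier_kernel:
  "(fourier_kernel t has_vector_derivative exp (- \<i> * of_real s * of_real t)) (at s)"
proof (cases "t = 0")
  case True
  have "(complex_of_real has_vector_derivative of_real 1) (at s)"
    by (rule has_vector_derivative_of_real) (rule DERIV_ident)
  then show ?thesis using True by (simp add: fourier_kernel_def[abs_def])
next
  case False
  have "((\<lambda>z. (1 - exp (- \<i> * z * of_real t)) / (\<i> * of_real t)) has_field_derivative
      exp (- \<i> * of_real s * of_real t)) (at (of_real s))"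
    using False by (auto intro!: derivative_eq_intros simp: field_simps)
  then have "((\<lambda>z. (1 - exp (- \<i> * z * of_real t)) / (\<i> * of_real t)) \<circ> of_real has_vector_derivative
      exp (- \<i> * of_real s * of_real t)) (at s)"
    using has_vector_derivative_real_field by (simp add: o_def)
  then show ?thesis using False by (simp add: o_def fourier_kernel_def[abs_def])
qed

lemma norm_exp_fourier: "norm (exp (- \<i> * of_real s * of_real t)) = 1"
  by (simp add: norm_exp_eq_Re)

lemma norm_fourier_kernel:
  "t \<noteq> 0 \<Longrightarrow> norm (fourier_kernel t s) = \<bar>2 * sin (s * t / 2) / t\<bar>"
proof -
  assume "t \<noteq> 0"
  moreover have "norm (1 - exp (- \<i> * of_real s * of_real t)) = 2 * \<bar>sin (s * t / 2)\<bar>"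
    using dist_exp_i_1[of "- s * t"] by (simp add: norm_minus_commute mult.assoc)
  ultimately show ?thesis
    by (simp add: fourier_kernel_def norm_divide norm_mult abs_mult)
qed

text \<open>The difference is the kernel at \<open>x - y\<close> times a number of modulus 1. Any
  bound on the kernel at one point thereby becomes a modulus of continuity.\<close>

lemma norm_fourier_kernel_diff:
  "norm (fourier_kernel t x - fourier_kernel t y) = norm (fourier_kernel t (x - y))"
proof (cases "t = 0")
  case False
  have "fourier_kernel t x - fourier_kernel t y = exp (- \<i> * of_real y * of_real t) * fourier_kernel t (x - y)"
    using False by (simp add: fourier_kernel_def field_simps exp_diff flip: exp_add)
  then show ?thesis by (simp add: norm_mult norm_exp_eq_Re)
qed (simp add: fourier_kernel_def flip: of_real_diff)

lemma norm_fourier_kernel_le: "norm (fourier_kernel t s) \<le> \<bar>s\<bar>"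
proof (cases "t = 0")
  case False
  have "\<bar>sin (s * t / 2)\<bar> \<le> \<bar>s * t / 2\<bar>" by (rule abs_sin_x_le_abs_x)
  then show ?thesis using False
    by (simp add: norm_fourier_kernel abs_mult field_simps)
qed (simp add: fourier_kernel_def)

lemma norm_fourier_kernel_bounded: "t \<noteq> 0 \<Longrightarrow> norm (fourier_kernel t s) \<le> 2 / \<bar>t\<bar>"
  by (simp add: norm_fourier_kernel abs_mult field_simps)

section \<open>The exact norm of the kernel as a function of the frequency\<close>

lemma nn_integral_even:
  fixes h :: "real \<Rightarrow> real"
  assumes [measurable]: "h \<in> borel_measurable borel" and even: "\<And>x. h (- x) = h x"
  shows "(\<integral>\<^sup>+ x. ennreal (h x) \<partial>lborel) = 2 * (\<integral>\<^sup>+ x. ennreal (h x) * indicator {0<..} x \<partial>lborel)"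
proof -
  have "(\<integral>\<^sup>+ x. ennreal (h x) * indicator {..<0} x \<partial>lborel)
      = ennreal \<bar>- 1\<bar> * (\<integral>\<^sup>+ x. ennreal (h (0 + (- 1) * x)) * indicator {..<0} (0 + (- 1) * x) \<partial>lborel)"
    by (rule nn_integral_real_affine) auto
  also have "\<dots> = (\<integral>\<^sup>+ x. ennreal (h x) * indicator {0<..} x \<partial>lborel)"
    by (simp add: even) (auto intro!: nn_integral_cong split: split_indicator)
  finally have neg: "(\<integral>\<^sup>+ x. ennreal (h x) * indicator {..<0} x \<partial>lborel)
      = (\<integral>\<^sup>+ x. ennreal (h x) * indicator {0<..} x \<partial>lborel)" .
  have "(\<integral>\<^sup>+ x. ennreal (h x) \<partial>lborel) = (\<integral>\<^sup>+ x. ennreal (h x) * indicator {0<..} x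
      + ennreal (h x) * indicator {..<0} x \<partial>lborel)"
  proof (rule nn_integral_cong_AE)
    show "AE x in lborel. ennreal (h x)
        = ennreal (h x) * indicator {0<..} x + ennreal (h x) * indicator {..<0} x"
      using AE_lborel_singleton[of 0] by eventually_elim (auto split: split_indicator)
  qed
  also have "\<dots> = (\<integral>\<^sup>+ x. ennreal (h x) * indicator {0<..} x \<partial>lborel)
      + (\<integral>\<^sup>+ x. ennreal (h x) * indicator {..<0} x \<partial>lborel)"
    by (intro nn_integral_add) auto
  finally show ?thesis unfolding neg mult_2 .
qed

text \<open>For finite \<open>q\<close>, \<open>C_const q\<close> is the \<open>q\<close>-th root of
  four times this number.\<close>

definition sinc_const :: "real \<Rightarrow> real" where
  "sinc_const q = (LINT t:{0<..}|lebesgue. \<bar>sin t / t\<bar> powr q)"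

lemma sinc_const_nonneg: "0 \<le> sinc_const q"
  unfolding sinc_const_def set_lebesgue_integral_def by (rule integral_nonneg_AE) simp

text \<open>The integrand is at most 1 on \<open>{0<..1}\<close> and at most
  \<open>u powr (- q)\<close> beyond, so it is integrable. Without this the Lebesgue integral in
  \<open>sinc_const\<close> could be the default value 0 of a divergent integral.\<close>

lemma nn_integral_sinc:
  assumes "q > 1"
  shows "(\<integral>\<^sup>+ u. ennreal (\<bar>sin u / u\<bar> powr q) * indicator {0<..} u \<partial>lborel) = ennreal (sinc_const q)"
proof -
  let ?h = "\<lambda>u::real. indicator {0<..} u *\<^sub>R \<bar>sin u / u\<bar> powr q"
  have eq: "(\<integral>\<^sup>+ u. ennreal (\<bar>sin u / u\<bar> powr q) * indicator {0<..} u \<partial>lborel) = (\<integral>\<^sup>+ u. ennreal (?h u) \<partial>lborel)"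
    by (intro nn_integral_cong) (auto split: split_indicator)
  have "(\<integral>\<^sup>+ u. ennreal (?h u) \<partial>lborel)
      \<le> (\<integral>\<^sup>+ u. indicator {0<..1} u + ennreal (u powr (- q)) * indicator {1..} u \<partial>lborel)"
  proof (rule nn_integral_mono)
    fix u :: real
    show "ennreal (?h u) \<le> indicator {0<..1} u + ennreal (u powr (- q)) * indicator {1..} u"
    proof (cases "u < 1")
      case True
      have "\<bar>sin u / u\<bar> \<le> 1"
        using abs_sin_x_le_abs_x[of u] by (cases "u = 0") (auto simp: abs_div field_simps)
      then have "\<bar>sin u / u\<bar> powr q \<le> 1"
        using powr_mono2[of q "\<bar>sin u / u\<bar>" 1] assms by simp
      then have "ennreal (\<bar>sin u / u\<bar> powr q) \<le> 1"
        using ennreal_leI by fastforce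
      then show ?thesis using True by (auto split: split_indicator intro: order_trans)
    next
      case False
      then have "\<bar>sin u / u\<bar> powr q \<le> (1 / u) powr q"
        using assms by (intro powr_mono2) (auto simp: abs_div divide_right_mono)
      also have "\<dots> = u powr (- q)" using False by (simp add: powr_divide powr_minus_divide)
      finally have "ennreal (\<bar>sin u / u\<bar> powr q) \<le> ennreal (u powr (- q))" by (rule ennreal_leI)
      also have "\<dots> \<le> indicator {0<..1} u + ennreal (u powr (- q)) * indicator {1..} u"
        using False by (simp add: add_increasing)
      finally show ?thesis using False by (simp del: abs_divide)
    qed
  qed
  also have "\<dots> = emeasure lborel {0<..1::real} + (\<integral>\<^sup>+ u. ennreal (u powr (- q)) * indicator {1..} u \<partial>lborel)"
    by (subst nn_integral_add) auto
  also have "\<dots> = 1 + ennreal (- (1 powr (- q + 1)) / (- q + 1))"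
    using nn_integral_has_integral_lebesgue'[OF _ has_integral_powr_to_inf[of "- q" 1]] assms by simp
  also have "\<dots> < \<infinity>" by simp
  finally have "integrable lborel ?h"
    by (intro integrableI_nonneg) auto
  then show ?thesis unfolding eq sinc_const_def set_lebesgue_integral_def
    by (subst integral_completion) (auto intro!: nn_integral_eq_integral)
qed

text \<open>The substitution \<open>t = 2 / \<bar>s\<bar> * u\<close> turns the modulus of the
  kernel into \<open>\<bar>s\<bar> * \<bar>sin u / u\<bar>\<close>. The factor 4 is 2 from the
  substitution times 2 from evenness.\<close>

lemma nn_integral_fourier_kernel_powr:
  assumes "q > 1"
  shows "(\<integral>\<^sup>+ t. ennreal (norm (fourier_kernel t s) powr q) \<partial>lborel)
    = ennreal (4 * sinc_const q * \<bar>s\<bar> powr (q - 1))"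
proof (cases "s = 0")
  case True
  then show ?thesis using assms by simp
next
  case False
  let ?h = "\<lambda>t. ennreal (norm (fourier_kernel t s) powr q)"
  have "(\<integral>\<^sup>+ t. ?h t \<partial>lborel) = ennreal \<bar>2 / \<bar>s\<bar>\<bar> * (\<integral>\<^sup>+ u. ?h (0 + 2 / \<bar>s\<bar> * u) \<partial>lborel)"
    using False by (intro nn_integral_real_affine) auto
  also have "(\<integral>\<^sup>+ u. ?h (0 + 2 / \<bar>s\<bar> * u) \<partial>lborel)
      = (\<integral>\<^sup>+ u. ennreal (\<bar>s\<bar> powr q) * ennreal (\<bar>sin u / u\<bar> powr q) \<partial>lborel)"
  proof (rule nn_integral_cong_AE)
    show "AE u in lborel. ?h (0 + 2 / \<bar>s\<bar> * u) = ennreal (\<bar>s\<bar> powr q) * ennreal (\<bar>sin u / u\<bar> powr q)"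
      using AE_lborel_singleton[of 0]
    proof eventually_elim
      case (elim u)
      have "\<bar>sin (s * u / \<bar>s\<bar>)\<bar> = \<bar>sin u\<bar>"
        using False by (cases "s > 0") auto
      then have "norm (fourier_kernel (2 / \<bar>s\<bar> * u) s) = \<bar>s\<bar> * \<bar>sin u / u\<bar>"
        using elim False by (subst norm_fourier_kernel) (auto simp: abs_mult field_simps)
      then show ?case
        using powr_mult[of "\<bar>s\<bar>" "\<bar>sin u / u\<bar>" q] by (simp add: ennreal_mult[symmetric])
    qed
  qed
  also have "\<dots> = ennreal (\<bar>s\<bar> powr q) * (2 * ennreal (sinc_const q))"
    by (subst nn_integral_cmult, simp, subst nn_integral_even) (simp_all only: nn_integral_sinc[OF assms], auto)
  also have "ennreal \<bar>2 / \<bar>s\<bar>\<bar> * \<dots> = ennreal (2 / \<bar>s\<bar> * (\<bar>s\<bar> powr q * (2 * sinc_const q)))"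
    by (simp add: ennreal_mult[symmetric] sinc_const_nonneg flip: ennreal_numeral)
  also have "2 / \<bar>s\<bar> * (\<bar>s\<bar> powr q * (2 * sinc_const q)) = 4 * sinc_const q * \<bar>s\<bar> powr (q - 1)"
    using False by (simp add: powr_diff)
  finally show ?thesis .
qed

lemma conjugate_exponent_cases:
  fixes p :: real and q :: ennreal
  assumes "1 \<le> p" "1 / ennreal p + 1 / q = 1"
  obtains "p = 1" "q = \<infinity>"
  | r where "1 < p" "1 < r" "q = ennreal r" "1 / p + 1 / r = 1"
proof (cases q)
  case top
  then have "ennreal (1 / p) = ennreal 1"
    using assms divide_ennreal[of 1 p] by simp
  then have "p = 1" using assms(1) by (subst (asm) ennreal_inj) auto
  then show ?thesis using that(1) top by simp
next
  case (real r)
  \<comment> \<open>In \<open>ennreal\<close> the quotient \<open>1 / 0\<close> is infinite, which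
    the equation for the exponents excludes.\<close>
  have "r \<noteq> 0" using assms real by (auto simp: ennreal_divide_zero)
  then have r: "r > 0" using real by simp
  have "ennreal (1 / p + 1 / r) = ennreal 1"
    using assms(1,2) divide_ennreal[of 1 p] divide_ennreal[of 1 r] r real(2) by simp
  then have eq: "1 / p + 1 / r = 1"
    using assms(1) r by (subst (asm) ennreal_inj) auto
  have "1 / p < 1" "1 / r < 1" using eq r assms(1)
    by (smt (verit) zero_less_divide_1_iff)+
  then have "1 < p" "1 < r" using r assms(1) by (auto simp: field_simps)
  then show ?thesis using that(2) real(2) eq by blast
qed

lemma fourier_kernel_measurable_lebesgue [measurable]:
  "(\<lambda>t. fourier_kernel t s) \<in> borel_measurable lebesgue"
  by (rule measurable_completion) simp

lemma C_const_ennreal: "0 \<le> r \<Longrightarrow> C_const (ennreal r) = 4 powr (1 / r) * sinc_const r powr (1 / r)"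
  unfolding C_const_def sinc_const_def by simp

lemma C_const_nonneg: "0 \<le> C_const q"
  unfolding C_const_def by simp

text \<open>Hoelder's inequality with the exact norm of the kernel, where
  \<open>(r - 1) / r = 1 / p\<close>; for \<open>p = 1\<close> the kernel is at most
  \<open>\<bar>s\<bar>\<close>. The modulus stands inside the integral so that Tonelli's theorem can
  be used with it.\<close>

lemma nn_integral_mult_fourier_kernel_le:
  fixes f :: "real \<Rightarrow> complex"
  assumes p: "1 \<le> p" and q: "1 / ennreal p + 1 / q = 1" and f: "in_Lp (ennreal p) f"
  shows "(\<integral>\<^sup>+ t. ennreal (norm (f t) * norm (fourier_kernel t s)) \<partial>lebesgue)
    \<le> ennreal (C_const q * Lp_norm p f * \<bar>s\<bar> powr (1 / p))"
proof -
  have [measurable]: "f \<in> borel_measurable lebesgue" using f by (simp add: in_Lp_def)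
  have int: "integrable lebesgue (\<lambda>x. norm (f x) powr p)"
    using f p by (simp add: in_Lp_def)
  then have eq: "(\<integral>\<^sup>+ x. ennreal (norm (f x) powr p) \<partial>lebesgue)
      = ennreal (LINT x|lebesgue. norm (f x) powr p)"
    by (intro nn_integral_eq_integral) auto
  from p q show ?thesis
  proof (cases rule: conjugate_exponent_cases)
    case 1
    have "(\<integral>\<^sup>+ t. ennreal (norm (f t) * norm (fourier_kernel t s)) \<partial>lebesgue)
        \<le> (\<integral>\<^sup>+ t. ennreal \<bar>s\<bar> * ennreal (norm (f t) powr p) \<partial>lebesgue)"
    proof (rule nn_integral_mono)
      fix t
      have "norm (f t) * norm (fourier_kernel t s) \<le> \<bar>s\<bar> * norm (f t)"
        by (subst mult.commute) (intro mult_right_mono norm_fourier_kernel_le norm_ge_zero)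
      then show "ennreal (norm (f t) * norm (fourier_kernel t s)) \<le> ennreal \<bar>s\<bar> * ennreal (norm (f t) powr p)"
        using 1 by (simp add: ennreal_mult[symmetric] ennreal_leI)
    qed
    also have "\<dots> = ennreal \<bar>s\<bar> * (\<integral>\<^sup>+ t. ennreal (norm (f t) powr p) \<partial>lebesgue)"
      by (rule nn_integral_cmult) measurable
    also have "\<dots> = ennreal (C_const q * Lp_norm p f * \<bar>s\<bar> powr (1 / p))"
      unfolding eq using 1 by (simp add: C_const_def Lp_norm_def ennreal_mult mult.commute)
    finally show ?thesis .
  next
    case (2 r)
    let ?A = "LINT x|lebesgue. norm (f x) powr p" and ?B = "4 * sinc_const r * \<bar>s\<bar> powr (r - 1)"
    have "(\<integral>\<^sup>+ t. ennreal (norm (f t) * norm (fourier_kernel t s)) \<partial>lebesgue)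
        \<le> ennreal (?A powr (1 / p) * ?B powr (1 / r))"
      using 2 eq nn_integral_fourier_kernel_powr[of r s] sinc_const_nonneg[of r]
      by (intro nn_integral_Holder) (auto simp: nn_integral_completion intro!: integral_nonneg)
    also have "?B powr (1 / r) = C_const q * \<bar>s\<bar> powr (1 / p)"
    proof -
      have "(r - 1) / r = 1 / p" using 2 by (simp add: field_simps)
      then show ?thesis
        using 2 C_const_ennreal[of r] by (simp add: powr_mult powr_powr sinc_const_nonneg)
    qed
    finally show ?thesis by (simp add: Lp_norm_def ac_simps)
  qed
qed

section \<open>The Fourier transform of a function of bounded variation\<close>

locale fourier_bv = bv_function +
  fixes p :: real
  assumes p: "1 \<le> p"
    and lim_top: "(g \<longlongrightarrow> 0) at_top"
    and lim_bot: "(g \<longlongrightarrow> 0) at_bot"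
    and moment: "integrable m (\<lambda>s. \<bar>s\<bar> powr (1 / p))"
begin

definition remainder :: "real \<Rightarrow> real \<Rightarrow> real \<Rightarrow> complex" where
  "remainder t = parts_remainder (fourier_kernel t) (\<lambda>s. exp (- \<i> * of_real s * of_real t)) g"

definition tail_moment :: "real \<Rightarrow> real" where
  "tail_moment R = (LINT y|m. \<bar>y\<bar> powr (1 / p) * indicator {y. R \<le> \<bar>y\<bar>} y)"

lemma integrable_tail_moment: "integrable m (\<lambda>y. \<bar>y\<bar> powr (1 / p) * indicator {y. R \<le> \<bar>y\<bar>} y)"
  by (rule Bochner_Integration.integrable_bound[OF moment]) (auto split: split_indicator)

lemma nn_integral_tail_moment:
  "(\<integral>\<^sup>+ y. ennreal (\<bar>y\<bar> powr (1 / p)) * indicator {y. R \<le> \<bar>y\<bar>} y \<partial>m) = ennreal (tail_moment R)"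
  unfolding tail_moment_def
  by (subst nn_integral_eq_integral[OF integrable_tail_moment, symmetric])
    (auto intro!: nn_integral_cong split: split_indicator)

lemma tail_moment_nonneg: "0 \<le> tail_moment R"
  unfolding tail_moment_def by (rule integral_nonneg_AE) simp

lemma tail_moment_antimono: "R \<le> S \<Longrightarrow> tail_moment S \<le> tail_moment R"
  unfolding tail_moment_def
  by (intro integral_mono integrable_tail_moment) (auto split: split_indicator)

text \<open>Dominated convergence along the integers. The condition \<open>R \<ge> 1\<close> is
  included because it gives \<open>1 \<le> \<bar>y\<bar> powr (1 / p)\<close> on the tail.\<close>

lemma tail_moment_small:
  assumes "e > 0"
  shows "\<exists>R\<ge>1. tail_moment R < e"
proof -
  have "(\<lambda>n. LINT y|m. \<bar>y\<bar> powr (1 / p) * indicator {y. real n \<le> \<bar>y\<bar>} y) \<longlonglongrightarrow> (LINT y|m. 0)"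
  proof (rule integral_dominated_convergence[where w = "\<lambda>s. \<bar>s\<bar> powr (1 / p)"])
    show "AE y in m. (\<lambda>n. \<bar>y\<bar> powr (1 / p) * indicator {y. real n \<le> \<bar>y\<bar>} y) \<longlonglongrightarrow> 0"
    proof (rule AE_I2)
      fix y :: real
      obtain N where N: "\<bar>y\<bar> < real N" using reals_Archimedean2 by blast
      have "\<forall>\<^sub>F n in sequentially. \<bar>y\<bar> powr (1 / p) * indicator {y. real n \<le> \<bar>y\<bar>} y = 0"
        using eventually_ge_at_top[of N] by eventually_elim (use N in auto)
      then show "(\<lambda>n. \<bar>y\<bar> powr (1 / p) * indicator {y. real n \<le> \<bar>y\<bar>} y) \<longlonglongrightarrow> 0"
        by (rule tendsto_eventually)
    qed
  qed (use moment in \<open>auto split: split_indicator\<close>)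
  then have "(\<lambda>n. tail_moment (real n)) \<longlonglongrightarrow> 0" by (simp add: tail_moment_def)
  then have "\<forall>\<^sub>F n in sequentially. tail_moment (real n) < e"
    using assms by (rule order_tendstoD)
  then have "\<forall>\<^sub>F n in sequentially. 1 \<le> real n \<and> tail_moment (real n) < e"
    using eventually_ge_at_top[of 1] by eventually_elim auto
  then show ?thesis by (metis (mono_tags, lifting) eventually_happens' sequentially_bot)
qed

lemma continuous_fourier_exp: "continuous_on UNIV (\<lambda>s. exp (- \<i> * of_real s * of_real t))"
  by (intro continuous_intros)

lemma norm_fourier_exp_le: "norm (exp (- \<i> * of_real s * of_real t)) \<le> 1"
  using norm_exp_fourier by simp

lemmas kernel_facts = has_vector_derivative_fourier_kernel continuous_fourier_exp norm_fourier_exp_le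

lemma remainder_add:
  "a \<le> b \<Longrightarrow> b \<le> c \<Longrightarrow> remainder t a c = remainder t a b + remainder t b c"
  unfolding remainder_def by (rule parts_remainder_add[OF kernel_facts])

definition kernel_tail :: "real \<Rightarrow> real \<Rightarrow> ennreal" where
  "kernel_tail R t = (\<integral>\<^sup>+ y. ennreal (norm (fourier_kernel t y)) * indicator {y. R \<le> \<bar>y\<bar>} y \<partial>m)"

text \<open>Both half-open intervals in \<open>parts_remainder_le\<close> lie in the tail; the
  factor 2 there and the two intervals make 4.\<close>

lemma remainder_le_kernel_tail:
  assumes "a \<le> b" "b \<le> - R \<or> R \<le> a" "0 \<le> R"
  shows "ennreal (norm (remainder t a b)) \<le> 4 * kernel_tail R t"
proof -
  have "ennreal (norm (remainder t a b)) \<le> 2 * (kernel_tail R t + kernel_tail R t)"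
    unfolding remainder_def kernel_tail_def using assms
    by (intro order_trans[OF parts_remainder_le[OF kernel_facts]] mult_left_mono add_mono nn_integral_mono)
      (auto split: split_indicator)
  also have "\<dots> = 4 * kernel_tail R t"
    by (simp add: mult_2[symmetric] mult.assoc[symmetric])
  finally show ?thesis .
qed

lemma remainder_diff_le_kernel_tail:
  assumes "a \<le> c" "c \<le> - R" "R \<le> d" "d \<le> b" "0 \<le> R"
  shows "ennreal (norm (remainder t a b - remainder t c d)) \<le> 8 * kernel_tail R t"
proof -
  have "remainder t a b = remainder t a c + (remainder t c d + remainder t d b)"
    using assms remainder_add[of a c b t] remainder_add[of c d b t] by simp
  then have "norm (remainder t a b - remainder t c d) \<le> norm (remainder t a c) + norm (remainder t d b)"
    by (simp add: norm_triangle_ineq)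
  then have "ennreal (norm (remainder t a b - remainder t c d))
      \<le> ennreal (norm (remainder t a c)) + ennreal (norm (remainder t d b))"
    by (simp add: ennreal_plus[symmetric] ennreal_leI del: ennreal_plus)
  also have "\<dots> \<le> 4 * kernel_tail R t + 4 * kernel_tail R t"
    using assms by (intro add_mono remainder_le_kernel_tail) auto
  also have "\<dots> = 8 * kernel_tail R t"
    by (simp add: distrib_right[symmetric])
  finally show ?thesis .
qed

text \<open>For fixed \<open>t \<noteq> 0\<close> the kernel is at most
  \<open>2 / \<bar>t\<bar>\<close>, and \<open>\<bar>y\<bar> powr (1 / p)\<close> is at least 1 on
  the tail.\<close>

lemma kernel_tail_le:
  assumes "t \<noteq> 0" "1 \<le> R"
  shows "kernel_tail R t \<le> ennreal (2 / \<bar>t\<bar> * tail_moment R)"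
proof -
  have "kernel_tail R t \<le> (\<integral>\<^sup>+ y. ennreal (2 / \<bar>t\<bar>) * (ennreal (\<bar>y\<bar> powr (1 / p)) * indicator {y. R \<le> \<bar>y\<bar>} y) \<partial>m)"
    unfolding kernel_tail_def
  proof (rule nn_integral_mono)
    fix y :: real
    show "ennreal (norm (fourier_kernel t y)) * indicator {y. R \<le> \<bar>y\<bar>} y
        \<le> ennreal (2 / \<bar>t\<bar>) * (ennreal (\<bar>y\<bar> powr (1 / p)) * indicator {y. R \<le> \<bar>y\<bar>} y)"
    proof (cases "R \<le> \<bar>y\<bar>")
      case True
      then have "1 \<le> \<bar>y\<bar> powr (1 / p)"
        using assms p by (intro ge_one_powr_ge_zero) auto
      then have "norm (fourier_kernel t y) * 1 \<le> 2 / \<bar>t\<bar> * \<bar>y\<bar> powr (1 / p)"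
        using assms norm_fourier_kernel_bounded[of t y] by (intro mult_mono) auto
      then show ?thesis using True by (simp add: ennreal_mult[symmetric] ennreal_leI)
    qed simp
  qed
  also have "\<dots> = ennreal (2 / \<bar>t\<bar> * tail_moment R)"
    by (subst nn_integral_cmult) (auto simp: nn_integral_tail_moment ennreal_mult[symmetric] tail_moment_nonneg)
  finally show ?thesis .
qed

lemma remainder_diff_le:
  assumes "a \<le> c" "c \<le> - R" "R \<le> d" "d \<le> b" "1 \<le> R" "t \<noteq> 0"
  shows "norm (remainder t a b - remainder t c d) \<le> 16 / \<bar>t\<bar> * tail_moment R"
proof -
  have "ennreal (norm (remainder t a b - remainder t c d)) \<le> 8 * ennreal (2 / \<bar>t\<bar> * tail_moment R)"
    using assms by (intro order_trans[OF remainder_diff_le_kernel_tail[of a c R d b t]]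
        mult_left_mono kernel_tail_le) auto
  also have "\<dots> = ennreal (8 * (2 / \<bar>t\<bar> * tail_moment R))"
    by (subst ennreal_mult) (auto simp: tail_moment_nonneg)
  finally show ?thesis
    by (subst (asm) ennreal_le_iff) (auto simp: tail_moment_nonneg)
qed

section \<open>Convergence of the improper integral defining the transform\<close>

lemma g_small:
  assumes "e > 0"
  shows "\<exists>R. \<forall>y. R \<le> \<bar>y\<bar> \<longrightarrow> \<bar>g y\<bar> < e"
proof -
  obtain N where N: "\<And>y. N \<le> y \<Longrightarrow> \<bar>g y\<bar> < e"
    using tendstoD[OF lim_top assms] by (auto simp: eventually_at_top_linorder)
  obtain M where M: "\<And>y. y \<le> M \<Longrightarrow> \<bar>g y\<bar> < e"
    using tendstoD[OF lim_bot assms] by (auto simp: eventually_at_bot_linorder)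
  have "\<bar>g y\<bar> < e" if "max N (- M) \<le> \<bar>y\<bar>" for y
    using N[of y] M[of y] that by (cases "0 \<le> y") auto
  then show ?thesis by blast
qed

lemma integral_eq_remainder:
  "integral {a..b} (\<lambda>s. exp (- \<i> * of_real s * of_real t) * of_real (g s))
    = fourier_kernel t b * of_real (g b) - fourier_kernel t a * of_real (g a) - remainder t a b"
  by (simp add: remainder_def parts_remainder_def)

lemma kernel_mult_small:
  assumes "t \<noteq> 0" "\<bar>x\<bar> \<le> e * \<bar>t\<bar> / 2"
  shows "norm (fourier_kernel t s * of_real x) \<le> e"
proof -
  have "norm (fourier_kernel t s * of_real x) \<le> 2 / \<bar>t\<bar> * (e * \<bar>t\<bar> / 2)"
    unfolding norm_mult norm_of_real
    using assms norm_fourier_kernel_bounded[of t s] by (intro mult_mono) auto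
  then show ?thesis using assms by simp
qed

text \<open>Cauchy's criterion: an integral over \<open>{a..b}\<close> is a pair of boundary terms
  minus a remainder. The boundary terms are small because \<open>g\<close> vanishes at infinity, and
  remainders over large intervals differ by little because of the tail moment.\<close>

lemma fourier_integrable:
  assumes t: "t \<noteq> 0"
  shows "(\<lambda>s. exp (- \<i> * of_real s * of_real t) * of_real (g s) :: complex) integrable_on UNIV"
    (is "?F integrable_on UNIV")
proof (subst integrable_alt, intro conjI allI impI)
  fix a b :: real
  show "(\<lambda>x. if x \<in> UNIV then ?F x else 0) integrable_on cbox a b"
    using integrable_mult_g[OF continuous_fourier_exp norm_fourier_exp_le] by simp
next
  fix e :: real assume e: "e > 0"
  \<comment> \<open>The remainders will differ by at most \<open>e / 8\<close> and each of four
    boundary terms will be at most \<open>e / 16\<close>. Together this is \<open>3 * e / 8\<close>,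
    so any large interval gives a value within \<open>e / 2\<close> of \<open>J\<close>.\<close>
  have "0 < e / 8 * \<bar>t\<bar> / 16" using e t by simp
  from tail_moment_small[OF this] obtain R1 where R1: "1 \<le> R1" "tail_moment R1 < e / 8 * \<bar>t\<bar> / 16" by blast
  have "0 < e / 16 * \<bar>t\<bar> / 2" using e t by simp
  from g_small[OF this] obtain R2 where R2: "\<And>y. R2 \<le> \<bar>y\<bar> \<Longrightarrow> \<bar>g y\<bar> < e / 16 * \<bar>t\<bar> / 2" by blast
  define R where "R = max R1 R2"
  have R: "1 \<le> R" "tail_moment R < e / 8 * \<bar>t\<bar> / 16"
    using R1 tail_moment_antimono[of R1 R] by (auto simp: R_def)
  have gR: "norm (fourier_kernel t s * of_real (g y)) \<le> e / 16" if "R \<le> \<bar>y\<bar>" for y s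
    using R2[of y] that by (intro kernel_mult_small[OF t]) (auto simp: R_def)
  define J where "J = integral {- R..R} ?F"
  have J: "norm (integral {a..b} ?F - J) < e / 2" if "a \<le> - R" "R \<le> b" for a b
  proof -
    have "norm (remainder t a b - remainder t (- R) R) \<le> 16 / \<bar>t\<bar> * tail_moment R"
      using that R t by (intro remainder_diff_le) auto
    also have "\<dots> \<le> e / 8" using R(2) t by (simp add: field_simps)
    finally have r: "norm (remainder t a b - remainder t (- R) R) \<le> e / 8" .
    have "norm (integral {a..b} ?F - J) =
      norm ((fourier_kernel t b * of_real (g b) - fourier_kernel t a * of_real (g a))
        - (fourier_kernel t R * of_real (g R) - fourier_kernel t (- R) * of_real (g (- R)))
        - (remainder t a b - remainder t (- R) R))"
      unfolding J_def integral_eq_remainder by (simp add: algebra_simps)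
    also have "\<dots> \<le> (e / 16 + e / 16) + (e / 16 + e / 16) + e / 8"
      using that R(1) by (intro order_trans[OF norm_triangle_ineq4] add_mono gR r) auto
    also have "\<dots> < e / 2" using e by simp
    finally show ?thesis .
  qed
  show "\<exists>B>0. \<forall>a b c d. ball 0 B \<subseteq> cbox a b \<and> ball 0 B \<subseteq> cbox c d \<longrightarrow>
      norm (integral (cbox a b) (\<lambda>x. if x \<in> UNIV then ?F x else 0)
        - integral (cbox c d) (\<lambda>x. if x \<in> UNIV then ?F x else 0)) < e"
  proof (intro exI[of _ R] conjI allI impI)
    show "0 < R" using R by simp
    fix a b c d :: real
    assume "ball 0 R \<subseteq> cbox a b \<and> ball 0 R \<subseteq> cbox c d"
    then have "a \<le> - R" "R \<le> b" "c \<le> - R" "R \<le> d"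
      using R greaterThanLessThan_subseteq_atLeastAtMost_iff[of "- R" R]
      by (auto simp: ball_eq_greaterThanLessThan)
    then have "norm (integral {a..b} ?F - J - (integral {c..d} ?F - J)) < e / 2 + e / 2"
      by (intro le_less_trans[OF norm_triangle_ineq4 add_strict_mono] J)
    then show "norm (integral (cbox a b) (\<lambda>x. if x \<in> UNIV then ?F x else 0)
        - integral (cbox c d) (\<lambda>x. if x \<in> UNIV then ?F x else 0)) < e" by simp
  qed
qed

text \<open>This makes the improper integral the limit of a sequence, so that bounds and
  measurability pass to it.\<close>

lemma integral_symmetric_tendsto:
  assumes "t \<noteq> 0"
  shows "(\<lambda>n. integral {- real n..real n} (\<lambda>s. exp (- \<i> * of_real s * of_real t) * of_real (g s)))
    \<longlonglongrightarrow> fourier_transform g t"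
proof (rule LIMSEQ_I)
  fix e :: real assume "e > 0"
  let ?F = "\<lambda>s. exp (- \<i> * of_real s * of_real t) * of_real (g s) :: complex"
  have "(?F has_integral fourier_transform g t) UNIV"
    unfolding fourier_transform_def using fourier_integrable[OF assms] by (rule integrable_integral)
  then obtain B where B: "B > 0"
    "\<And>a b. ball 0 B \<subseteq> cbox a b \<Longrightarrow> norm (integral (cbox a b) ?F - fourier_transform g t) < e"
    using \<open>e > 0\<close> unfolding has_integral_alt'[of ?F] by auto
  obtain N where N: "B < real N" using reals_Archimedean2 by blast
  have "norm (integral {- real n..real n} ?F - fourier_transform g t) < e" if "N \<le> n" for n
  proof -
    have "ball 0 B \<subseteq> cbox (- real n) (real n)"
      using that N by (auto simp: ball_eq_greaterThanLessThan)
    from B(2)[OF this] show ?thesis by simp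
  qed
  then show "\<exists>N. \<forall>n\<ge>N. norm (integral {- real n..real n} ?F - fourier_transform g t) < e" by blast
qed

lemma boundary_tendsto:
  assumes t: "t \<noteq> 0" and h: "\<And>e. e > 0 \<Longrightarrow> \<exists>R. \<forall>y. R \<le> \<bar>y\<bar> \<longrightarrow> \<bar>h y\<bar> \<le> e"
    and x: "\<And>n. \<bar>x n\<bar> = real n"
  shows "(\<lambda>n. fourier_kernel t (x n) * of_real (h (x n))) \<longlonglongrightarrow> 0"
proof (rule LIMSEQ_I)
  fix e :: real assume e: "e > 0"
  then have "0 < e / 2 * \<bar>t\<bar> / 2" using t by simp
  from h[OF this] obtain R where R: "\<And>y. R \<le> \<bar>y\<bar> \<Longrightarrow> \<bar>h y\<bar> \<le> e / 2 * \<bar>t\<bar> / 2" by blast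
  obtain N where N: "R < real N" using reals_Archimedean2 by blast
  have "norm (fourier_kernel t (x n) * of_real (h (x n)) - 0) < e" if "N \<le> n" for n
  proof -
    have "norm (fourier_kernel t (x n) * of_real (h (x n))) \<le> e / 2"
      using that N x[of n] by (intro kernel_mult_small[OF t] R) auto
    then show ?thesis using e by simp
  qed
  then show "\<exists>N. \<forall>n\<ge>N. norm (fourier_kernel t (x n) * of_real (h (x n)) - 0) < e" by blast
qed

lemma G_small:
  assumes "e > 0"
  shows "\<exists>R. \<forall>y. R \<le> \<bar>y\<bar> \<longrightarrow> \<bar>G y\<bar> \<le> e"
proof -
  obtain R where R: "\<And>y. R \<le> \<bar>y\<bar> \<Longrightarrow> \<bar>g y\<bar> < e" using g_small[OF assms] by blast
  \<comment> \<open>The margin 1 is for negative \<open>y\<close>: points just to the right of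
    \<open>y\<close> have smaller modulus and must still be at distance \<open>R\<close> from
    0.\<close>
  have "\<bar>G y\<bar> \<le> e" if y: "\<bar>R\<bar> + 1 \<le> \<bar>y\<bar>" for y
  proof (rule tendsto_upperbound[OF tendsto_rabs[OF tendsto_G] _ trivial_limit_at_right_real])
    show "\<forall>\<^sub>F s in at_right y. \<bar>g s\<bar> \<le> e"
      unfolding eventually_at_right_field
    proof (intro exI[of _ "y + 1"] conjI allI impI)
      fix s assume "y < s" "s < y + 1"
      then have "R \<le> \<bar>s\<bar>" using y by linarith
      then show "\<bar>g s\<bar> \<le> e" using R by (simp add: less_imp_le)
    qed simp
  qed
  then show ?thesis by blast
qed

lemma parts_remainder_tendsto:
  assumes t: "t \<noteq> 0" and h: "\<And>e. e > 0 \<Longrightarrow> \<exists>R. \<forall>y. R \<le> \<bar>y\<bar> \<longrightarrow> \<bar>h y\<bar> \<le> e"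
  shows "(\<lambda>n. parts_remainder (fourier_kernel t) (\<lambda>s. exp (- \<i> * of_real s * of_real t)) h
      (- real n) (real n)) \<longlonglongrightarrow> - fourier_transform g t"
proof -
  have "(\<lambda>n. fourier_kernel t (real n) * of_real (h (real n))
      - fourier_kernel t (- real n) * of_real (h (- real n))
      - integral {- real n..real n} (\<lambda>s. exp (- \<i> * of_real s * of_real t) * of_real (g s)))
    \<longlonglongrightarrow> 0 - 0 - fourier_transform g t"
    by (intro tendsto_diff boundary_tendsto[OF t h] integral_symmetric_tendsto[OF t]) auto
  then show ?thesis by (simp add: parts_remainder_def)
qed

lemma remainder_tendsto:
  assumes "t \<noteq> 0"
  shows "(\<lambda>n. remainder t (- real n) (real n)) \<longlonglongrightarrow> - fourier_transform g t"
  unfolding remainder_def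
proof (rule parts_remainder_tendsto[OF assms])
  fix e :: real assume "e > 0"
  then show "\<exists>R. \<forall>y. R \<le> \<bar>y\<bar> \<longrightarrow> \<bar>g y\<bar> \<le> e"
    using g_small by (meson less_imp_le)
qed

text \<open>The remainders taken with \<open>G\<close> have the same limit as those with
  \<open>g\<close>, but their bound has the factor 1. This keeps the constant
  \<open>C_const q\<close> of the final estimate sharp.\<close>

lemma norm_fourier_transform_le:
  assumes t: "t \<noteq> 0"
  shows "ennreal (norm (fourier_transform g t)) \<le> (\<integral>\<^sup>+ y. ennreal (norm (fourier_kernel t y)) \<partial>m)"
proof (rule LIMSEQ_le_const2)
  show "(\<lambda>n. ennreal (norm (parts_remainder (fourier_kernel t) (\<lambda>s. exp (- \<i> * of_real s * of_real t)) G
      (- real n) (real n)))) \<longlonglongrightarrow> ennreal (norm (fourier_transform g t))"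
    using tendsto_norm[OF parts_remainder_tendsto[OF t G_small]] by (intro tendsto_ennrealI) simp
  have "ennreal (norm (parts_remainder (fourier_kernel t) (\<lambda>s. exp (- \<i> * of_real s * of_real t)) G
      (- real n) (real n))) \<le> (\<integral>\<^sup>+ y. ennreal (norm (fourier_kernel t y)) \<partial>m)" for n
    by (rule order_trans[OF parts_remainder_right_limit_le[OF kernel_facts]])
      (auto intro!: nn_integral_mono split: split_indicator)
  then show "\<exists>N. \<forall>n\<ge>N. ennreal (norm (parts_remainder (fourier_kernel t)
      (\<lambda>s. exp (- \<i> * of_real s * of_real t)) G (- real n) (real n)))
      \<le> (\<integral>\<^sup>+ y. ennreal (norm (fourier_kernel t y)) \<partial>m)" by blast
qed

text \<open>Let the larger interval in \<open>remainder_diff_le_kernel_tail\<close> exhaust the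
  line.\<close>

lemma remainder_plus_fourier_transform_le:
  assumes t: "t \<noteq> 0" and ab: "a \<le> - R" "R \<le> b" "0 \<le> R"
  shows "ennreal (norm (remainder t a b + fourier_transform g t)) \<le> 8 * kernel_tail R t"
proof (rule LIMSEQ_le_const2)
  have "(\<lambda>n. norm (remainder t (- real n) (real n) - remainder t a b))
      \<longlonglongrightarrow> norm (- fourier_transform g t - remainder t a b)"
    by (intro tendsto_intros remainder_tendsto t)
  also have "norm (- fourier_transform g t - remainder t a b) = norm (remainder t a b + fourier_transform g t)"
    by (metis add.commute minus_add_distrib norm_minus_cancel uminus_add_conv_diff)
  finally show "(\<lambda>n. ennreal (norm (remainder t (- real n) (real n) - remainder t a b)))
      \<longlonglongrightarrow> ennreal (norm (remainder t a b + fourier_transform g t))"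
    by (rule tendsto_ennrealI)
  obtain N where N: "max (- a) b < real N" using reals_Archimedean2 by blast
  show "\<exists>N. \<forall>n\<ge>N. ennreal (norm (remainder t (- real n) (real n) - remainder t a b)) \<le> 8 * kernel_tail R t"
    using N ab by (intro exI[of _ N] allI impI remainder_diff_le_kernel_tail) auto
qed

end

text \<open>Borel sets keep their measure under completion. The fact serves Tonelli's theorem, where
  \<open>f\<close> is only Lebesgue measurable.\<close>

lemma sigma_finite_lebesgue: "sigma_finite_measure (lebesgue :: real measure)"
proof
  have "\<exists>A::real set set. countable A \<and> A \<subseteq> sets lborel \<and> \<Union>A = space lborel
      \<and> (\<forall>a\<in>A. emeasure lborel a \<noteq> \<infinity>)"
    by (rule lborel.sigma_finite_countable)
  then obtain A :: "real set set" where A: "countable A" "A \<subseteq> sets lborel" "\<Union>A = space lborel"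
      "\<forall>a\<in>A. emeasure lborel a \<noteq> \<infinity>"
    by blast
  then have "emeasure lebesgue a \<noteq> \<infinity>" if "a \<in> A" for a
    using that by (simp add: emeasure_completion subset_iff)
  then show "\<exists>A::real set set. countable A \<and> A \<subseteq> sets lebesgue \<and> \<Union>A = space lebesgue
      \<and> (\<forall>a\<in>A. emeasure lebesgue a \<noteq> \<infinity>)"
    using A by (intro exI[of _ A]) (auto intro!: sets_completionI_sets)
qed

lemma AE_lebesgue_neq: "AE x in lebesgue. x \<noteq> (c::real)"
  by (rule AE_completion) (rule AE_lborel_singleton)

section \<open>Measurability and integrability of the transform, and decay of
  \<open>g\<close>\<close>

context fourier_bv
begin

lemma measurable_fourier_transform [measurable]: "fourier_transform g \<in> borel_measurable borel"
proof -
  let ?F = "\<lambda>t s. exp (- \<i> * of_real s * of_real t) * of_real (g s) :: complex"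
  define L where "L n t = (LINT s|lborel. indicator {- real n..real n} s *\<^sub>R ?F t s)" for n t
  have [measurable]: "(\<lambda>t. L n t) \<in> borel_measurable borel" for n
    unfolding L_def by (rule lborel.borel_measurable_lebesgue_integral) measurable
  have L: "L n t = integral {- real n..real n} (?F t)" for n t
  proof -
    obtain B where B: "\<bar>g s\<bar> \<le> B" for s using bounded_g by blast
    have "set_integrable lborel {- real n..real n} (?F t)"
      unfolding set_integrable_def
    proof (rule integrableI_bounded_set_indicator[where B = B])
      show "AE x in lborel. x \<in> {- real n..real n} \<longrightarrow> norm (?F t x) \<le> B"
        using B norm_exp_fourier by (simp add: norm_mult)
    qed (auto simp: emeasure_lborel_Icc_eq)
    from set_borel_integral_eq_integral(2)[OF this] show ?thesis
      by (simp add: L_def set_lebesgue_integral_def)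
  qed
  \<comment> \<open>The point 0 is set apart because the truncated integrals need not converge
    there.\<close>
  have eq: "fourier_transform g = (\<lambda>t. if t = 0 then fourier_transform g 0 else lim (\<lambda>n. L n t))"
    unfolding L using limI[OF integral_symmetric_tendsto, symmetric]
    by (auto simp only: fun_eq_iff split: if_split)
  have "(\<lambda>t. if t = 0 then fourier_transform g 0 else lim (\<lambda>n. L n t)) \<in> borel_measurable borel"
  proof (rule measurable_If)
    show "(\<lambda>t. lim (\<lambda>n. L n t)) \<in> borel_measurable borel"
      by (rule borel_measurable_lim_metric) measurable
    have "{t \<in> space borel. t = 0} = {0 :: real}" by auto
    then show "{t \<in> space borel. t = (0 :: real)} \<in> sets borel" by simp
  qed simp
  then show ?thesis by (subst eq)
qed

definition moment_integral :: real where
  "moment_integral = (LINT s|m. \<bar>s\<bar> powr (1 / p))"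

lemma moment_integral_nonneg: "0 \<le> moment_integral"
  unfolding moment_integral_def by (rule integral_nonneg_AE) simp

lemma nn_integral_moment: "(\<integral>\<^sup>+ s. ennreal (\<bar>s\<bar> powr (1 / p)) \<partial>m) = ennreal moment_integral"
  unfolding moment_integral_def by (rule nn_integral_eq_integral[OF moment]) simp

text \<open>The bound \<open>\<bar>y\<bar>\<close> on the kernel does not depend on
  \<open>t\<close>, and for \<open>p = 1\<close> its integral is the given moment.\<close>

lemma fourier_transform_in_L_infinity:
  assumes "p = 1"
  shows "in_Lp \<infinity> (fourier_transform g)"
proof -
  have le: "norm (fourier_transform g t) \<le> moment_integral" if "t \<noteq> 0" for t
  proof -
    have "ennreal (norm (fourier_transform g t)) \<le> (\<integral>\<^sup>+ y. ennreal (norm (fourier_kernel t y)) \<partial>m)"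
      by (rule norm_fourier_transform_le[OF that])
    also have "\<dots> \<le> (\<integral>\<^sup>+ y. ennreal (\<bar>y\<bar> powr (1 / p)) \<partial>m)"
      using norm_fourier_kernel_le assms by (intro nn_integral_mono ennreal_leI) simp
    finally show ?thesis unfolding nn_integral_moment
      by (subst (asm) ennreal_le_iff) (rule moment_integral_nonneg)
  qed
  have "AE t in lebesgue. norm (fourier_transform g t) \<le> moment_integral"
    using AE_lebesgue_neq[of 0] by eventually_elim (rule le)
  then show ?thesis unfolding in_Lp_def by (auto intro: measurable_completion)
qed

text \<open>Hoelder's inequality with respect to \<open>|dg|\<close> is applied to the product of
  \<open>|s| powr (1 / p\<^sup>2)\<close> and \<open>|fourier_kernel t s| * |s| powr (- 1 / p\<^sup>2)\<close>; this choice of the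
  weight makes the \<open>L\<^sup>q\<close> norm in \<open>t\<close> of the second factor integrate to a multiple of
  \<open>|s| powr (1 / p)\<close>.\<close>

lemma fourier_transform_in_Lq:
  assumes p1: "1 < p" and r: "1 < r" "1 / p + 1 / r = 1"
  shows "in_Lp (ennreal r) (fourier_transform g)"
proof -
  let ?v = "\<lambda>t y. norm (fourier_kernel t y) * \<bar>y\<bar> powr (- 1 / p\<^sup>2)"
  let ?A = moment_integral
  define B where "B t = (\<integral>\<^sup>+ y. ennreal (?v t y powr r) \<partial>m)" for t
  interpret pair: pair_sigma_finite "lborel :: real measure" m ..
  have [measurable]: "B \<in> borel_measurable borel"
    unfolding B_def by (rule m.borel_measurable_nn_integral) measurable
  \<comment> \<open>From \<open>r = p / (p - 1)\<close> one gets \<open>r - 1 = 1 / (p - 1)\<close>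
    and \<open>r / p\<^sup>2 = 1 / (p * (p - 1))\<close>.\<close>
  have exps: "(r - 1) - r / p\<^sup>2 = 1 / p"
  proof -
    have "r * (p - 1) = p" using p1 r by (simp add: field_simps)
    then have "r = p / (p - 1)" using p1 by (simp add: field_simps)
    then show ?thesis using p1 by (simp add: divide_simps power2_eq_square) (simp add: algebra_simps)
  qed
  have "(\<integral>\<^sup>+ t. B t \<partial>lborel) = (\<integral>\<^sup>+ y. (\<integral>\<^sup>+ t. ennreal (?v t y powr r) \<partial>lborel) \<partial>m)"
    unfolding B_def by (rule pair.Fubini'[symmetric]) measurable
  also have "\<dots> = (\<integral>\<^sup>+ y. ennreal (4 * sinc_const r) * ennreal (\<bar>y\<bar> powr (1 / p)) \<partial>m)"
  proof (rule nn_integral_cong)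
    fix y :: real
    have "(\<integral>\<^sup>+ t. ennreal (?v t y powr r) \<partial>lborel)
        = (\<integral>\<^sup>+ t. ennreal (\<bar>y\<bar> powr (- r / p\<^sup>2)) * ennreal (norm (fourier_kernel t y) powr r) \<partial>lborel)"
      by (intro nn_integral_cong) (simp add: powr_mult powr_powr ennreal_mult[symmetric] mult.commute)
    also have "\<dots> = ennreal (\<bar>y\<bar> powr (- r / p\<^sup>2)) * ennreal (4 * sinc_const r * \<bar>y\<bar> powr (r - 1))"
      by (subst nn_integral_cmult) (auto simp: nn_integral_fourier_kernel_powr[OF r(1)])
    also have "\<dots> = ennreal (4 * sinc_const r * (\<bar>y\<bar> powr (- r / p\<^sup>2) * \<bar>y\<bar> powr (r - 1)))"
      by (simp add: ennreal_mult[symmetric] sinc_const_nonneg ac_simps)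
    also have "\<bar>y\<bar> powr (- r / p\<^sup>2) * \<bar>y\<bar> powr (r - 1) = \<bar>y\<bar> powr (1 / p)"
      using exps by (simp add: powr_add[symmetric])
    finally show "(\<integral>\<^sup>+ t. ennreal (?v t y powr r) \<partial>lborel)
        = ennreal (4 * sinc_const r) * ennreal (\<bar>y\<bar> powr (1 / p))"
      by (simp add: ennreal_mult[symmetric] sinc_const_nonneg)
  qed
  also have "\<dots> = ennreal (4 * sinc_const r) * ennreal ?A"
    by (subst nn_integral_cmult) (auto simp: nn_integral_moment)
  finally have intB: "(\<integral>\<^sup>+ t. B t \<partial>lborel) < \<infinity>" by (simp add: ennreal_mult_less_top)
  then have finB: "AE t in lborel. B t \<noteq> \<infinity>"
    by (intro nn_integral_PInf_AE) auto
  \<comment> \<open>Hoelder's inequality raised to the power \<open>r\<close>: the factor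
    \<open>B t\<close> then appears to the first power and has a finite integral in
    \<open>t\<close>.\<close>
  have bound: "ennreal (norm (fourier_transform g t) powr r) \<le> ennreal (?A powr (r / p)) * B t"
    if t: "t \<noteq> 0" "B t \<noteq> \<infinity>" for t
  proof -
    define b where "b = enn2real (B t)"
    have b: "B t = ennreal b" "0 \<le> b" using t(2) by (auto simp: b_def less_top)
    have "ennreal (norm (fourier_transform g t)) \<le> (\<integral>\<^sup>+ y. ennreal (norm (fourier_kernel t y)) \<partial>m)"
      by (rule norm_fourier_transform_le[OF t(1)])
    also have "\<dots> = (\<integral>\<^sup>+ y. ennreal (\<bar>y\<bar> powr (1 / p\<^sup>2) * ?v t y) \<partial>m)"
    proof (intro nn_integral_cong arg_cong[where f = ennreal])
      fix y :: real
      \<comment> \<open>At \<open>y = 0\<close> the weights do not cancel, as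
        \<open>0 powr x = 0\<close>, but the kernel vanishes there.\<close>
      show "norm (fourier_kernel t y) = \<bar>y\<bar> powr (1 / p\<^sup>2) * ?v t y"
        by (cases "y = 0") (auto simp: powr_minus field_simps)
    qed
    also have "\<dots> \<le> ennreal (?A powr (1 / p) * b powr (1 / r))"
    proof (rule nn_integral_Holder[OF p1 r])
      have "1 / p\<^sup>2 * p = 1 / p" using p1 by (simp add: power2_eq_square)
      then show "(\<integral>\<^sup>+ y. ennreal ((\<bar>y\<bar> powr (1 / p\<^sup>2)) powr p) \<partial>m) \<le> ennreal ?A"
        by (simp add: powr_powr nn_integral_moment)
      show "(\<integral>\<^sup>+ y. ennreal (?v t y powr r) \<partial>m) \<le> ennreal b"
        using b(1) by (simp add: B_def)
    qed (auto simp: b moment_integral_nonneg)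
    finally have "norm (fourier_transform g t) \<le> ?A powr (1 / p) * b powr (1 / r)"
      by (subst (asm) ennreal_le_iff) auto
    then have "norm (fourier_transform g t) powr r \<le> (?A powr (1 / p) * b powr (1 / r)) powr r"
      using r by (intro powr_mono2) auto
    also have "\<dots> = ?A powr (r / p) * b"
      using r b by (simp add: powr_mult powr_powr)
    finally show ?thesis by (simp add: b ennreal_mult[symmetric] ennreal_leI)
  qed
  have "(\<integral>\<^sup>+ t. ennreal (norm (fourier_transform g t) powr r) \<partial>lborel)
      \<le> (\<integral>\<^sup>+ t. ennreal (?A powr (r / p)) * B t \<partial>lborel)"
    by (rule nn_integral_mono_AE) (use finB AE_lborel_singleton[of 0] in eventually_elim, rule bound)
  also have "\<dots> = ennreal (?A powr (r / p)) * (\<integral>\<^sup>+ t. B t \<partial>lborel)"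
    by (rule nn_integral_cmult) measurable
  also have "\<dots> < \<infinity>" using intB by (simp add: ennreal_mult_less_top)
  finally have "integrable lborel (\<lambda>t. norm (fourier_transform g t) powr r)"
    by (intro integrableI_nonneg) auto
  then have "integrable lebesgue (\<lambda>t. norm (fourier_transform g t) powr r)"
    by (subst integrable_completion) auto
  then show ?thesis unfolding in_Lp_def using r by (auto intro: measurable_completion)
qed

text \<open>As \<open>y\<close> moves from \<open>x\<close> away from the origin to infinity,
  \<open>\<bar>g y - g x\<bar>\<close> tends to \<open>\<bar>g x\<bar>\<close> and stays below the
  mass of \<open>?T\<close>. Markov's inequality bounds this mass by the tail moment; the factor 2
  covers \<open>2 powr (1 / p)\<close>.\<close>

lemma g_le_tail_moment:
  assumes x: "2 \<le> \<bar>x\<bar>"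
  shows "\<bar>g x\<bar> * \<bar>x\<bar> powr (1 / p) \<le> 2 * tail_moment (\<bar>x\<bar> / 2)"
proof -
  let ?T = "{y. \<bar>x\<bar> / 2 \<le> \<bar>y\<bar>}"
  have le: "\<bar>g y - g x\<bar> \<le> measure m ?T" if y: "0 < x \<and> x < y \<or> x < 0 \<and> y < x" for y
  proof -
    \<comment> \<open>The left end \<open>a\<close> must lie strictly below \<open>min x y\<close>
      to give \<open>W a \<le> V (min x y)\<close>; for positive \<open>x\<close> the room for this
      comes from cutting at half of \<open>\<bar>x\<bar>\<close>.\<close>
    define a b where "a = (if x < 0 then y - 1 else x / 2)" and "b = (if x < 0 then x else y)"
    have "\<bar>g y - g x\<bar> \<le> V b - V (min x y)"
      using y abs_diff_le_V[of x y] abs_diff_le_V[of y x] by (auto simp: b_def min_def abs_minus_commute)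
    also have "\<dots> \<le> W b - W a"
      using V_le_W[of b] W_le_V[of a "min x y"] y by (auto simp: a_def min_def)
    also have "\<dots> = measure m {a<..b}"
      using y x by (intro measure_Ioc[symmetric]) (auto simp: a_def b_def)
    also have "\<dots> \<le> measure m ?T"
      using y x by (intro m.finite_measure_mono) (auto simp: a_def b_def)
    finally show ?thesis .
  qed
  have "\<bar>g x\<bar> \<le> measure m ?T"
  proof (cases "0 < x")
    case True
    have "((\<lambda>y. \<bar>g y - g x\<bar>) \<longlongrightarrow> \<bar>0 - g x\<bar>) at_top"
      by (intro tendsto_intros lim_top)
    moreover have "\<forall>\<^sub>F y in at_top. \<bar>g y - g x\<bar> \<le> measure m ?T"
      using eventually_gt_at_top[of x] by eventually_elim (use True le in auto)
    ultimately show ?thesis using tendsto_upperbound[OF _ _ trivial_limit_at_top_linorder] by fastforce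
  next
    case False
    have "((\<lambda>y. \<bar>g y - g x\<bar>) \<longlongrightarrow> \<bar>0 - g x\<bar>) at_bot"
      by (intro tendsto_intros lim_bot)
    moreover have "\<forall>\<^sub>F y in at_bot. \<bar>g y - g x\<bar> \<le> measure m ?T"
      using eventually_gt_at_bot[of x] by eventually_elim (use False x le in auto)
    ultimately show ?thesis using tendsto_upperbound[OF _ _ trivial_limit_at_bot_linorder] by fastforce
  qed
  then have *: "\<bar>g x\<bar> * \<bar>x\<bar> powr (1 / p) \<le> measure m ?T * (2 * (\<bar>x\<bar> / 2) powr (1 / p))"
  proof (rule mult_mono)
    have "\<bar>x\<bar> powr (1 / p) = 2 powr (1 / p) * (\<bar>x\<bar> / 2) powr (1 / p)"
      by (subst powr_mult[symmetric]) auto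
    also have "2 powr (1 / p) \<le> (2::real) powr 1" using p by (intro powr_mono) auto
    finally show "\<bar>x\<bar> powr (1 / p) \<le> 2 * (\<bar>x\<bar> / 2) powr (1 / p)" by (simp add: mult_right_mono)
  qed auto
  have "measure m ?T * (\<bar>x\<bar> / 2) powr (1 / p) \<le> tail_moment (\<bar>x\<bar> / 2)"
  proof -
    have "measure m ?T * (\<bar>x\<bar> / 2) powr (1 / p) = (LINT y|m. (\<bar>x\<bar> / 2) powr (1 / p) * indicator ?T y)"
      by simp
    also have "\<dots> \<le> tail_moment (\<bar>x\<bar> / 2)"
      unfolding tail_moment_def
    proof (rule integral_mono[OF _ integrable_tail_moment])
      show "(\<bar>x\<bar> / 2) powr (1 / p) * indicator ?T y \<le> \<bar>y\<bar> powr (1 / p) * indicator ?T y" for y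
        using p by (auto split: split_indicator intro!: powr_mono2)
    qed (auto intro!: integrable_real_indicator simp: less_top[symmetric])
    finally show ?thesis .
  qed
  with * show ?thesis by linarith
qed

text \<open>The growth condition of \<open>fourier_pairing_defined\<close> follows since tail
  moments tend to 0.\<close>

lemma g_smallo: "g \<in> o[at_infinity](\<lambda>x. \<bar>x\<bar> powr (- 1 / p))"
proof (rule landau_o.smallI)
  fix c :: real assume c: "c > 0"
  then obtain R where R: "1 \<le> R" "tail_moment R < c / 2" using tail_moment_small[of "c / 2"] by auto
  show "\<forall>\<^sub>F x in at_infinity. norm (g x) \<le> c * norm (\<bar>x\<bar> powr (- 1 / p))"
    unfolding eventually_at_infinity
  proof (intro exI[of _ "2 * R"] allI impI)
    fix x :: real assume x: "2 * R \<le> norm x"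
    have "\<bar>g x\<bar> * \<bar>x\<bar> powr (1 / p) \<le> 2 * tail_moment (\<bar>x\<bar> / 2)"
      using x R by (intro g_le_tail_moment) auto
    also have "\<dots> \<le> c" using tail_moment_antimono[of R "\<bar>x\<bar> / 2"] x R by simp
    finally show "norm (g x) \<le> c * norm (\<bar>x\<bar> powr (- 1 / p))"
      using x R by (simp add: powr_minus field_simps)
  qed
qed

end

section \<open>Henstock-Stieltjes integrability\<close>

text \<open>By Cousin's lemma some division of a large interval is fine for both gauges, and its sum
  is close to both values.\<close>

lemma has_HS_integral_unique:
  assumes "has_HS_integral F g I" "has_HS_integral F g J"
  shows "I = J"
proof (rule ccontr)
  assume "I \<noteq> J"
  define e where "e = norm (I - J) / 2"
  have "e > 0" using \<open>I \<noteq> J\<close> by (simp add: e_def)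
  let ?S = "\<lambda>\<D>. \<Sum>(x, K)\<in>\<D>. (g (Sup K) - g (Inf K)) *\<^sub>R F x"
  obtain \<gamma>1 R1 where 1: "gauge \<gamma>1" "\<And>a b \<D>. a < - R1 \<Longrightarrow> R1 < b \<Longrightarrow> \<D> tagged_division_of {a..b}
      \<Longrightarrow> \<gamma>1 fine \<D> \<Longrightarrow> norm (?S \<D> - I) < e"
    using assms(1) \<open>e > 0\<close> unfolding has_HS_integral_def by meson
  obtain \<gamma>2 R2 where 2: "gauge \<gamma>2" "\<And>a b \<D>. a < - R2 \<Longrightarrow> R2 < b \<Longrightarrow> \<D> tagged_division_of {a..b}
      \<Longrightarrow> \<gamma>2 fine \<D> \<Longrightarrow> norm (?S \<D> - J) < e"
    using assms(2) \<open>e > 0\<close> unfolding has_HS_integral_def by meson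
  define R where "R = \<bar>R1\<bar> + \<bar>R2\<bar> + 1"
  obtain \<D> where \<D>: "\<D> tagged_division_of {- R..R}" "(\<lambda>x. \<gamma>1 x \<inter> \<gamma>2 x) fine \<D>"
    using fine_division_exists_real[OF gauge_Int[OF 1(1) 2(1)]] .
  have "norm (?S \<D> - I) < e" "norm (?S \<D> - J) < e"
    using \<D> by (auto simp: fine_Int R_def intro!: 1(2)[of "- R" R] 2(2)[of "- R" R])
  then have "norm ((?S \<D> - J) - (?S \<D> - I)) < e + e"
    by (intro le_less_trans[OF norm_triangle_ineq4 add_strict_mono])
  then show False by (simp add: e_def)
qed

lemma has_HS_integral_imp_HS_integral_eq: "has_HS_integral F g I \<Longrightarrow> HS_integral F g = I"
  unfolding HS_integral_def by (blast intro: the_equality has_HS_integral_unique)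

lemma tagged_division_of_real_cell:
  fixes a b :: real
  assumes "\<D> tagged_division_of {a..b}" "(x, K) \<in> \<D>"
  obtains u v where "K = {u..v}" "u \<le> v" "x \<in> K"
proof -
  obtain u v where "K = cbox u v" using tagged_division_ofD(4)[OF assms] by blast
  moreover have "x \<in> K" by (rule tagged_division_ofD(2)[OF assms])
  ultimately show ?thesis using that[of u v] by auto
qed

text \<open>All that is used about the size of \<open>f\<close> is the kernel bound with a constant
  \<open>D\<close>, which will be \<open>C_const q * Lp_norm p f\<close>.\<close>

locale fourier_pairing_setup = fourier_bv +
  fixes f :: "real \<Rightarrow> complex" and D :: real
  assumes f_measurable [measurable]: "f \<in> borel_measurable lebesgue"
    and D: "0 \<le> D"
    and kernel_bound: "\<And>s. (\<integral>\<^sup>+ t. ennreal (norm (f t) * norm (fourier_kernel t s)) \<partial>lebesgue)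
      \<le> ennreal (D * \<bar>s\<bar> powr (1 / p))"
begin

sublocale lebesgue_m: pair_sigma_finite "lebesgue :: real measure" m
  by (intro pair_sigma_finite.intro sigma_finite_lebesgue m.sigma_finite_measure_axioms)

lemma fourier_kernel_measurable_pair [measurable]:
  "(\<lambda>(t, y). fourier_kernel t (y - x)) \<in> borel_measurable (lebesgue \<Otimes>\<^sub>M m)"
proof -
  have "(\<lambda>z :: real \<times> real. (fst z, snd z - x)) \<in> lebesgue \<Otimes>\<^sub>M m \<rightarrow>\<^sub>M borel \<Otimes>\<^sub>M (borel :: real measure)"
  proof (rule measurable_Pair)
    have id: "(\<lambda>x. x) \<in> lebesgue \<rightarrow>\<^sub>M (borel :: real measure)"
      by (rule measurable_completion) simp
    show "(\<lambda>z :: real \<times> real. fst z) \<in> lebesgue \<Otimes>\<^sub>M m \<rightarrow>\<^sub>M borel"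
      by (rule measurable_compose[OF measurable_fst id])
  qed simp
  from measurable_compose[OF this fourier_kernel_measurable]
  show ?thesis by (simp add: case_prod_beta)
qed

lemma fourier_kernel_integral_measurable [measurable]:
  assumes [measurable]: "A \<in> sets borel"
  shows "(\<lambda>t. \<integral>\<^sup>+ y. ennreal (norm (fourier_kernel t (y - x))) * indicator A y \<partial>m) \<in> borel_measurable lebesgue"
  by (rule m.borel_measurable_nn_integral) measurable

text \<open>Tonelli's theorem and the kernel bound at \<open>y - x\<close>. It will be applied with
  \<open>x = 0\<close> to the whole line and to tails, and with a tag \<open>x\<close> to the cells
  of a division.\<close>

lemma nn_integral_f_kernel_le:
  assumes [measurable]: "A \<in> sets borel"
  shows "(\<integral>\<^sup>+ t. ennreal (norm (f t)) *
      (\<integral>\<^sup>+ y. ennreal (norm (fourier_kernel t (y - x))) * indicator A y \<partial>m) \<partial>lebesgue)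
    \<le> (\<integral>\<^sup>+ y. ennreal (D * \<bar>y - x\<bar> powr (1 / p)) * indicator A y \<partial>m)"
proof -
  have "(\<integral>\<^sup>+ t. ennreal (norm (f t)) *
      (\<integral>\<^sup>+ y. ennreal (norm (fourier_kernel t (y - x))) * indicator A y \<partial>m) \<partial>lebesgue)
    = (\<integral>\<^sup>+ t. (\<integral>\<^sup>+ y. ennreal (norm (f t)) * (ennreal (norm (fourier_kernel t (y - x))) * indicator A y) \<partial>m) \<partial>lebesgue)"
    by (intro nn_integral_cong nn_integral_cmult[symmetric]) measurable
  also have "\<dots> = (\<integral>\<^sup>+ y. (\<integral>\<^sup>+ t. ennreal (norm (f t)) * (ennreal (norm (fourier_kernel t (y - x))) * indicator A y) \<partial>lebesgue) \<partial>m)"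
    by (rule lebesgue_m.Fubini'[symmetric]) measurable
  also have "\<dots> \<le> (\<integral>\<^sup>+ y. ennreal (D * \<bar>y - x\<bar> powr (1 / p)) * indicator A y \<partial>m)"
  proof (rule nn_integral_mono)
    fix y :: real
    show "(\<integral>\<^sup>+ t. ennreal (norm (f t)) * (ennreal (norm (fourier_kernel t (y - x))) * indicator A y) \<partial>lebesgue)
        \<le> ennreal (D * \<bar>y - x\<bar> powr (1 / p)) * indicator A y"
      using kernel_bound[of "y - x"] by (auto simp: ennreal_mult split: split_indicator)
  qed
  finally show ?thesis .
qed

lemma nn_integral_f_fourier_transform_le:
  "(\<integral>\<^sup>+ t. ennreal (norm (f t * fourier_transform g t)) \<partial>lebesgue) \<le> ennreal (D * moment_integral)"
proof -
  have "(\<integral>\<^sup>+ t. ennreal (norm (f t * fourier_transform g t)) \<partial>lebesgue)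
      \<le> (\<integral>\<^sup>+ t. ennreal (norm (f t)) *
        (\<integral>\<^sup>+ y. ennreal (norm (fourier_kernel t (y - 0))) * indicator UNIV y \<partial>m) \<partial>lebesgue)"
  proof (rule nn_integral_mono_AE)
    show "AE t in lebesgue. ennreal (norm (f t * fourier_transform g t)) \<le> ennreal (norm (f t)) *
        (\<integral>\<^sup>+ y. ennreal (norm (fourier_kernel t (y - 0))) * indicator UNIV y \<partial>m)"
      using AE_lebesgue_neq[of 0]
      by eventually_elim (auto simp: norm_mult ennreal_mult intro!: mult_left_mono norm_fourier_transform_le)
  qed
  also have "\<dots> \<le> (\<integral>\<^sup>+ y. ennreal (D * \<bar>y - 0\<bar> powr (1 / p)) * indicator UNIV y \<partial>m)"
    by (rule nn_integral_f_kernel_le) simp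
  also have "\<dots> = (\<integral>\<^sup>+ y. ennreal D * ennreal (\<bar>y\<bar> powr (1 / p)) \<partial>m)"
    using D by (simp add: ennreal_mult)
  also have "\<dots> = ennreal (D * moment_integral)"
    using D by (subst nn_integral_cmult) (auto simp: nn_integral_moment ennreal_mult moment_integral_nonneg)
  finally show ?thesis .
qed

lemma fourier_transform_measurable_lebesgue [measurable]:
  "fourier_transform g \<in> borel_measurable lebesgue"
  by (rule measurable_completion) simp

lemma integrable_f_fourier_transform: "integrable lebesgue (\<lambda>t. f t * fourier_transform g t)"
  using nn_integral_f_fourier_transform_le
  by (intro integrableI_bounded) (auto intro: le_less_trans)

lemma norm_integral_f_fourier_transform_le:
  "norm (LINT t|lebesgue. f t * fourier_transform g t) \<le> D * moment_integral"
proof -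
  have "ennreal (norm (LINT t|lebesgue. f t * fourier_transform g t)) \<le> ennreal (D * moment_integral)"
    using integral_norm_bound_ennreal[OF integrable_f_fourier_transform]
      nn_integral_f_fourier_transform_le by (rule order_trans)
  then show ?thesis
    by (subst (asm) ennreal_le_iff) (simp add: D moment_integral_nonneg)
qed

section \<open>Comparison of Henstock-Stieltjes sums of \<open>Psi f\<close> with the
  transform\<close>

lemma integrable_kernel_f: "integrable lebesgue (\<lambda>t. fourier_kernel t s * f t)"
  using kernel_bound[of s]
  by (intro integrableI_bounded) (auto simp: norm_mult mult.commute intro: le_less_trans)

lemma Psi_eq: "Psi f s = (LINT t|lebesgue. fourier_kernel t s * f t)"
  unfolding Psi_def fourier_kernel_def ..

text \<open>The remainder over a cell is an increment of \<open>remainder t a\<close>, so the sum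
  telescopes.\<close>

lemma sum_remainder:
  assumes ab: "a \<le> b" and \<D>: "\<D> tagged_division_of {a..b}"
  shows "(\<Sum>(x, K)\<in>\<D>. remainder t (Inf K) (Sup K)) = remainder t a b"
proof -
  have "(\<Sum>(x, K)\<in>\<D>. remainder t (Inf K) (Sup K))
      = (\<Sum>(x, K)\<in>\<D>. remainder t a (Sup K) - remainder t a (Inf K))"
  proof (rule sum.cong[OF refl], clarify)
    fix x K assume xK: "(x, K) \<in> \<D>"
    obtain u v where "K = {u..v}" "u \<le> v" using tagged_division_of_real_cell[OF \<D> xK] by blast
    moreover have "K \<subseteq> {a..b}" using tagged_division_ofD(3)[OF \<D> xK] .
    ultimately show "remainder t (Inf K) (Sup K) = remainder t a (Sup K) - remainder t a (Inf K)"
      using remainder_add[of a u v t] by auto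
  qed
  also have "\<dots> = remainder t a b - remainder t a a"
    by (rule additive_tagged_division_1[OF ab \<D>])
  also have "remainder t a a = 0" by (simp add: remainder_def parts_remainder_def)
  finally show ?thesis by simp
qed

text \<open>Closed cells share end points, which may be atoms. Half-open cells instead give
  increments of the monotone functions of \<open>{..y}\<close> and \<open>{..<y}\<close>, whose
  total increase is at most the whole mass each.\<close>

lemma sum_measure_le:
  assumes ab: "a \<le> b" and \<D>: "\<D> tagged_division_of {a..b}"
  shows "(\<Sum>(x, K)\<in>\<D>. measure m {Inf K<..Sup K} + measure m {Inf K..<Sup K}) \<le> 2 * measure m UNIV"
proof -
  define h where "h y = measure m {..y} + measure m {..<y}" for y
  have "(\<Sum>(x, K)\<in>\<D>. measure m {Inf K<..Sup K} + measure m {Inf K..<Sup K})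
      = (\<Sum>(x, K)\<in>\<D>. h (Sup K) - h (Inf K))"
  proof (rule sum.cong[OF refl], clarify)
    fix x K assume xK: "(x, K) \<in> \<D>"
    obtain u v where "K = {u..v}" "u \<le> v" using tagged_division_of_real_cell[OF \<D> xK] by blast
    then have K: "Inf K = u" "Sup K = v" "u \<le> v" by auto
    have Diff: "{u<..v} = {..v} - {..u}" "{u..<v} = {..<v} - {..<u}" by auto
    have "measure m {u<..v} = measure m {..v} - measure m {..u}"
      "measure m {u..<v} = measure m {..<v} - measure m {..<u}"
      unfolding Diff by (rule m.finite_measure_Diff; use K in force)+
    then show "measure m {Inf K<..Sup K} + measure m {Inf K..<Sup K} = h (Sup K) - h (Inf K)"
      by (simp add: h_def K)
  qed
  also have "\<dots> = h b - h a" by (rule additive_tagged_division_1[OF ab \<D>])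
  also have "\<dots> \<le> h b"
    unfolding h_def using measure_nonneg[of m "{..a}"] measure_nonneg[of m "{..<a}"] by linarith
  also have "\<dots> \<le> 2 * measure m UNIV"
    unfolding h_def using m.bounded_measure[of "{..b}"] m.bounded_measure[of "{..<b}"] by simp
  finally show ?thesis .
qed

definition cell_error :: "real \<Rightarrow> real \<Rightarrow> real set \<Rightarrow> ennreal" where
  "cell_error t x K = (\<integral>\<^sup>+ y. ennreal (norm (fourier_kernel t (y - x))) * indicator {Inf K<..Sup K} y \<partial>m)
    + (\<integral>\<^sup>+ y. ennreal (norm (fourier_kernel t (y - x))) * indicator {Inf K..<Sup K} y \<partial>m)"

lemma cell_error_measurable [measurable]: "(\<lambda>t. cell_error t x K) \<in> borel_measurable lebesgue"
  unfolding cell_error_def by measurable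

lemma kernel_tail_measurable [measurable]: "kernel_tail R \<in> borel_measurable lebesgue"
  using fourier_kernel_integral_measurable[of "{y. R \<le> \<bar>y\<bar>}" 0]
  by (simp add: kernel_tail_def[abs_def])

text \<open>Subtracting the constant \<open>fourier_kernel t x\<close> from the kernel leaves its
  derivative unchanged and turns the difference into a remainder for a function that is small near
  the tag, to which \<open>parts_remainder_le\<close> applies.\<close>

lemma norm_cell_le:
  assumes "u \<le> v"
  shows "ennreal (norm ((g v - g u) *\<^sub>R fourier_kernel t x - remainder t u v)) \<le> 2 * cell_error t x {u..v}"
proof -
  let ?k = "\<lambda>s. fourier_kernel t s - fourier_kernel t x"
  have k: "(?k has_vector_derivative exp (- \<i> * of_real s * of_real t)) (at s)" for s
    using has_vector_derivative_diff[OF has_vector_derivative_fourier_kernel has_vector_derivative_const]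
    by fastforce
  have "(g v - g u) *\<^sub>R fourier_kernel t x - remainder t u v
      = - parts_remainder ?k (\<lambda>s. exp (- \<i> * of_real s * of_real t)) g u v"
    by (simp add: remainder_def parts_remainder_def scaleR_conv_of_real algebra_simps)
  then show ?thesis
    using parts_remainder_le[OF k continuous_fourier_exp norm_fourier_exp_le assms]
      assms by (simp add: cell_error_def norm_fourier_kernel_diff)
qed

text \<open>The remainders of the cells add up to the remainder over \<open>{a..b}\<close>, which
  misses \<open>- fourier_transform g t\<close> only by a tail.\<close>

lemma norm_sum_plus_fourier_transform_le:
  assumes t: "t \<noteq> 0" and R: "0 \<le> R" "a \<le> - R" "R \<le> b" and \<D>: "\<D> tagged_division_of {a..b}"
  shows "ennreal (norm ((\<Sum>(x, K)\<in>\<D>. (g (Sup K) - g (Inf K)) *\<^sub>R fourier_kernel t x) + fourier_transform g t))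
    \<le> (\<Sum>(x, K)\<in>\<D>. 2 * cell_error t x K) + 8 * kernel_tail R t"
proof -
  let ?c = "\<lambda>x K. (g (Sup K) - g (Inf K)) *\<^sub>R fourier_kernel t x - remainder t (Inf K) (Sup K)"
  have ab: "a \<le> b" using R by simp
  have "(\<Sum>(x, K)\<in>\<D>. (g (Sup K) - g (Inf K)) *\<^sub>R fourier_kernel t x) + fourier_transform g t
      = (\<Sum>(x, K)\<in>\<D>. ?c x K) + (remainder t a b + fourier_transform g t)"
    using sum_remainder[OF ab \<D>, of t] by (simp add: sum_subtractf case_prod_beta)
  then have "norm ((\<Sum>(x, K)\<in>\<D>. (g (Sup K) - g (Inf K)) *\<^sub>R fourier_kernel t x) + fourier_transform g t)
      \<le> norm (\<Sum>(x, K)\<in>\<D>. ?c x K) + norm (remainder t a b + fourier_transform g t)"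
    by (simp only: norm_triangle_ineq)
  also have "norm (\<Sum>(x, K)\<in>\<D>. ?c x K) \<le> (\<Sum>(x, K)\<in>\<D>. norm (?c x K))"
    unfolding case_prod_beta by (rule norm_sum)
  finally have "ennreal (norm ((\<Sum>(x, K)\<in>\<D>. (g (Sup K) - g (Inf K)) *\<^sub>R fourier_kernel t x) + fourier_transform g t))
      \<le> ennreal ((\<Sum>(x, K)\<in>\<D>. norm (?c x K)) + norm (remainder t a b + fourier_transform g t))"
    by (simp add: ennreal_leI)
  also have "\<dots> = (\<Sum>(x, K)\<in>\<D>. ennreal (norm (?c x K))) + ennreal (norm (remainder t a b + fourier_transform g t))"
    by (subst ennreal_plus) (auto simp: case_prod_beta sum_ennreal intro!: sum_nonneg)
  also have "\<dots> \<le> (\<Sum>(x, K)\<in>\<D>. 2 * cell_error t x K) + 8 * kernel_tail R t"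
  proof (intro add_mono sum_mono remainder_plus_fourier_transform_le t R, clarify)
    fix x K assume xK: "(x, K) \<in> \<D>"
    obtain u v where "K = {u..v}" "u \<le> v" using tagged_division_of_real_cell[OF \<D> xK] by blast
    then show "ennreal (norm (?c x K)) \<le> 2 * cell_error t x K"
      using norm_cell_le[of u v t x] by auto
  qed
  finally show ?thesis .
qed

lemma nn_integral_f_cell_error_le:
  assumes \<delta>: "0 \<le> \<delta>" and K: "K = {u..v}" "x \<in> K" "K \<subseteq> ball x \<delta>"
  shows "(\<integral>\<^sup>+ t. ennreal (norm (f t)) * cell_error t x K \<partial>lebesgue)
    \<le> ennreal (D * \<delta> powr (1 / p) * (measure m {Inf K<..Sup K} + measure m {Inf K..<Sup K}))"
proof -
  have le: "(\<integral>\<^sup>+ t. ennreal (norm (f t)) *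
      (\<integral>\<^sup>+ y. ennreal (norm (fourier_kernel t (y - x))) * indicator A y \<partial>m) \<partial>lebesgue)
      \<le> ennreal (D * \<delta> powr (1 / p) * measure m A)" if A[measurable]: "A \<in> sets borel" and "A \<subseteq> K" for A
  proof -
    have "(\<integral>\<^sup>+ y. ennreal (D * \<bar>y - x\<bar> powr (1 / p)) * indicator A y \<partial>m)
        \<le> (\<integral>\<^sup>+ y. ennreal (D * \<delta> powr (1 / p)) * indicator A y \<partial>m)"
    proof (rule nn_integral_mono)
      fix y
      have "D * \<bar>y - x\<bar> powr (1 / p) \<le> D * \<delta> powr (1 / p)" if "y \<in> A"
        using that \<open>A \<subseteq> K\<close> K(3) D p
        by (intro mult_left_mono powr_mono2) (auto simp: dist_real_def subset_iff)
      then show "ennreal (D * \<bar>y - x\<bar> powr (1 / p)) * indicator A y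
          \<le> ennreal (D * \<delta> powr (1 / p)) * indicator A y"
        by (auto split: split_indicator intro: ennreal_leI)
    qed
    also have "\<dots> = ennreal (D * \<delta> powr (1 / p) * measure m A)"
      using D by (subst nn_integral_cmult_indicator) (auto simp: m.emeasure_eq_measure ennreal_mult)
    finally show ?thesis using nn_integral_f_kernel_le[OF A, of x] by (rule order_trans[rotated])
  qed
  have "u \<le> v" using K by auto
  have "(\<integral>\<^sup>+ t. ennreal (norm (f t)) * cell_error t x K \<partial>lebesgue)
    = (\<integral>\<^sup>+ t. ennreal (norm (f t)) *
      (\<integral>\<^sup>+ y. ennreal (norm (fourier_kernel t (y - x))) * indicator {Inf K<..Sup K} y \<partial>m) \<partial>lebesgue)
    + (\<integral>\<^sup>+ t. ennreal (norm (f t)) *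
      (\<integral>\<^sup>+ y. ennreal (norm (fourier_kernel t (y - x))) * indicator {Inf K..<Sup K} y \<partial>m) \<partial>lebesgue)"
    unfolding cell_error_def distrib_left by (rule nn_integral_add) measurable
  also have "\<dots> \<le> ennreal (D * \<delta> powr (1 / p) * measure m {Inf K<..Sup K})
      + ennreal (D * \<delta> powr (1 / p) * measure m {Inf K..<Sup K})"
    using K(1) \<open>u \<le> v\<close> by (intro add_mono le) auto
  also have "\<dots> = ennreal (D * \<delta> powr (1 / p) * (measure m {Inf K<..Sup K} + measure m {Inf K..<Sup K}))"
    using D by (subst ennreal_plus[symmetric]) (auto simp: distrib_left)
  finally show ?thesis .
qed

text \<open>The estimate for fixed \<open>t\<close> is multiplied by \<open>f t\<close> and
  integrated. The factor 4 is 2 from \<open>norm_cell_le\<close> times 2 from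
  \<open>sum_measure_le\<close>, and 8 comes from the tails.\<close>

lemma norm_HS_sum_le:
  assumes R: "0 \<le> R" "a \<le> - R" "R \<le> b" and \<delta>: "0 < \<delta>"
    and \<D>: "\<D> tagged_division_of {a..b}" and fine: "(\<lambda>x. ball x \<delta>) fine \<D>"
  shows "norm ((\<Sum>(x, K)\<in>\<D>. (g (Sup K) - g (Inf K)) *\<^sub>R Psi f x)
      + (LINT t|lebesgue. f t * fourier_transform g t))
    \<le> 4 * D * \<delta> powr (1 / p) * measure m UNIV + 8 * D * tail_moment R"
proof -
  let ?T = "\<lambda>t. (\<Sum>(x, K)\<in>\<D>. (g (Sup K) - g (Inf K)) *\<^sub>R fourier_kernel t x) + fourier_transform g t"
  have int: "integrable lebesgue (\<lambda>t. (g (Sup K) - g (Inf K)) *\<^sub>R (fourier_kernel t x * f t))" for x K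
    by (intro integrable_scaleR_right integrable_kernel_f)
  \<comment> \<open>A Henstock-Stieltjes sum is finite, so it can be moved under the integral that
    defines \<open>Psi f\<close>.\<close>
  have eq: "f t * ?T t = (\<Sum>(x, K)\<in>\<D>. (g (Sup K) - g (Inf K)) *\<^sub>R (fourier_kernel t x * f t))
      + f t * fourier_transform g t" for t
    by (simp add: distrib_left sum_distrib_left case_prod_beta mult.commute)
  have int2: "integrable lebesgue (\<lambda>t. f t * ?T t)"
    unfolding eq by (intro Bochner_Integration.integrable_add Bochner_Integration.integrable_sum
        integrable_f_fourier_transform) (auto intro: int)
  have "(LINT t|lebesgue. f t * ?T t)
      = (\<Sum>z\<in>\<D>. LINT t|lebesgue. (case z of (x, K) \<Rightarrow> (g (Sup K) - g (Inf K)) *\<^sub>R (fourier_kernel t x * f t)))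
        + (LINT t|lebesgue. f t * fourier_transform g t)"
    unfolding eq
    by (subst Bochner_Integration.integral_add)
      (auto intro!: Bochner_Integration.integrable_sum integrable_f_fourier_transform
        Bochner_Integration.integral_sum intro: int)
  also have "(\<Sum>z\<in>\<D>. LINT t|lebesgue. (case z of (x, K) \<Rightarrow> (g (Sup K) - g (Inf K)) *\<^sub>R (fourier_kernel t x * f t)))
      = (\<Sum>(x, K)\<in>\<D>. (g (Sup K) - g (Inf K)) *\<^sub>R Psi f x)"
    by (intro sum.cong) (auto simp: Psi_eq)
  finally have "ennreal (norm ((\<Sum>(x, K)\<in>\<D>. (g (Sup K) - g (Inf K)) *\<^sub>R Psi f x)
      + (LINT t|lebesgue. f t * fourier_transform g t)))
      \<le> (\<integral>\<^sup>+ t. ennreal (norm (f t * ?T t)) \<partial>lebesgue)"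
    using integral_norm_bound_ennreal[OF int2] by simp
  also have "\<dots> \<le> (\<integral>\<^sup>+ t. (\<Sum>(x, K)\<in>\<D>. 2 * (ennreal (norm (f t)) * cell_error t x K))
      + 8 * (ennreal (norm (f t)) * kernel_tail R t) \<partial>lebesgue)"
  proof (rule nn_integral_mono_AE)
    show "AE t in lebesgue. ennreal (norm (f t * ?T t)) \<le> (\<Sum>(x, K)\<in>\<D>. 2 * (ennreal (norm (f t)) * cell_error t x K))
      + 8 * (ennreal (norm (f t)) * kernel_tail R t)"
      using AE_lebesgue_neq[of 0]
    proof eventually_elim
      case (elim t)
      have "ennreal (norm (f t * ?T t)) = ennreal (norm (f t)) * ennreal (norm (?T t))"
        by (simp add: norm_mult ennreal_mult)
      also have "\<dots> \<le> ennreal (norm (f t)) * ((\<Sum>(x, K)\<in>\<D>. 2 * cell_error t x K) + 8 * kernel_tail R t)"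
        by (rule mult_left_mono[OF norm_sum_plus_fourier_transform_le[OF elim R \<D>]]) simp
      also have "\<dots> = (\<Sum>(x, K)\<in>\<D>. 2 * (ennreal (norm (f t)) * cell_error t x K))
          + 8 * (ennreal (norm (f t)) * kernel_tail R t)"
        by (simp add: distrib_left sum_distrib_left case_prod_beta mult.left_commute)
      finally show ?case .
    qed
  qed
  also have "\<dots> = (\<Sum>(x, K)\<in>\<D>. 2 * (\<integral>\<^sup>+ t. ennreal (norm (f t)) * cell_error t x K \<partial>lebesgue))
      + 8 * (\<integral>\<^sup>+ t. ennreal (norm (f t)) * kernel_tail R t \<partial>lebesgue)"
    by (simp add: nn_integral_add nn_integral_sum nn_integral_cmult case_prod_beta)
  also have "\<dots> \<le> (\<Sum>(x, K)\<in>\<D>. 2 * ennreal (D * \<delta> powr (1 / p)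
        * (measure m {Inf K<..Sup K} + measure m {Inf K..<Sup K}))) + 8 * ennreal (D * tail_moment R)"
  proof (intro add_mono mult_left_mono sum_mono)
    show "(case z of (x, K) \<Rightarrow> 2 * (\<integral>\<^sup>+ t. ennreal (norm (f t)) * cell_error t x K \<partial>lebesgue))
        \<le> (case z of (x, K) \<Rightarrow> 2 * ennreal (D * \<delta> powr (1 / p)
          * (measure m {Inf K<..Sup K} + measure m {Inf K..<Sup K})))" if "z \<in> \<D>" for z
    proof -
      obtain x K where z: "z = (x, K)" by (cases z)
      with that have xK: "(x, K) \<in> \<D>" by simp
      obtain u v where "K = {u..v}" "x \<in> K" using tagged_division_of_real_cell[OF \<D> xK] by blast
      moreover have "K \<subseteq> ball x \<delta>" using fineD[OF fine xK] .
      ultimately show ?thesis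
        unfolding z prod.case using \<delta> by (intro mult_left_mono nn_integral_f_cell_error_le) auto
    qed
    have "(\<integral>\<^sup>+ t. ennreal (norm (f t)) * kernel_tail R t \<partial>lebesgue)
        \<le> (\<integral>\<^sup>+ y. ennreal (D * \<bar>y - 0\<bar> powr (1 / p)) * indicator {y. R \<le> \<bar>y\<bar>} y \<partial>m)"
      using nn_integral_f_kernel_le[of "{y. R \<le> \<bar>y\<bar>}" 0] by (simp add: kernel_tail_def)
    also have "\<dots> = (\<integral>\<^sup>+ y. ennreal D * (ennreal (\<bar>y\<bar> powr (1 / p)) * indicator {y. R \<le> \<bar>y\<bar>} y) \<partial>m)"
      using D by (simp add: ennreal_mult mult.assoc)
    also have "\<dots> = ennreal (D * tail_moment R)"
      using D by (subst nn_integral_cmult) (auto simp: nn_integral_tail_moment ennreal_mult tail_moment_nonneg)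
    finally show "(\<integral>\<^sup>+ t. ennreal (norm (f t)) * kernel_tail R t \<partial>lebesgue) \<le> ennreal (D * tail_moment R)" .
  qed simp
  also have "\<dots> = ennreal ((\<Sum>(x, K)\<in>\<D>. 2 * (D * \<delta> powr (1 / p)
        * (measure m {Inf K<..Sup K} + measure m {Inf K..<Sup K}))) + 8 * (D * tail_moment R))"
    using D tail_moment_nonneg[of R]
    by (subst ennreal_plus)
      (auto simp: case_prod_beta sum_ennreal[symmetric] ennreal_mult simp flip: ennreal_numeral intro!: sum_nonneg)
  also have "(\<Sum>(x, K)\<in>\<D>. 2 * (D * \<delta> powr (1 / p) * (measure m {Inf K<..Sup K} + measure m {Inf K..<Sup K})))
      = 2 * D * \<delta> powr (1 / p) * (\<Sum>(x, K)\<in>\<D>. measure m {Inf K<..Sup K} + measure m {Inf K..<Sup K})"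
    by (simp add: sum_distrib_left case_prod_beta mult.assoc)
  finally have "norm ((\<Sum>(x, K)\<in>\<D>. (g (Sup K) - g (Inf K)) *\<^sub>R Psi f x)
      + (LINT t|lebesgue. f t * fourier_transform g t))
    \<le> 2 * D * \<delta> powr (1 / p) * (\<Sum>(x, K)\<in>\<D>. measure m {Inf K<..Sup K} + measure m {Inf K..<Sup K})
      + 8 * (D * tail_moment R)"
    using D tail_moment_nonneg[of R]
    by (subst (asm) ennreal_le_iff) (auto intro!: add_nonneg_nonneg mult_nonneg_nonneg sum_nonneg)
  also have "\<dots> \<le> 2 * D * \<delta> powr (1 / p) * (2 * measure m UNIV) + 8 * (D * tail_moment R)"
    using R D \<D> by (intro add_mono mult_left_mono sum_measure_le) auto
  finally show ?thesis by (simp add: mult_ac)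
qed

text \<open>A gauge of constant radius suffices because \<open>Psi f\<close> is uniformly Hoelder
  continuous with exponent \<open>1 / p\<close> and \<open>|dg|\<close> has finite mass;
  \<open>R\<close> is chosen by the tail moment.\<close>

lemma has_HS_integral_Psi:
  "has_HS_integral (Psi f) g (- (LINT t|lebesgue. f t * fourier_transform g t))"
  unfolding has_HS_integral_def
proof (intro allI impI)
  fix e :: real assume e: "e > 0"
  \<comment> \<open>This gives \<open>8 * (D + 1) * c = e / 2\<close> for the tails;
    \<open>D + 1\<close> replaces \<open>D\<close> to avoid division by zero.\<close>
  define c where "c = e / (16 * (D + 1))"
  have c: "c > 0" using e D by (simp add: c_def)
  obtain R where R: "1 \<le> R" "tail_moment R < c" using tail_moment_small[OF c] by blast
  \<comment> \<open>Chosen so that the errors of the cells are at most \<open>e / 2\<close> once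
    \<open>\<delta> powr (1 / p) = \<eta>\<close>.\<close>
  define \<eta> where "\<eta> = e / (8 * (D + 1) * (measure m UNIV + 1))"
  have \<eta>: "\<eta> > 0" using e D by (simp add: \<eta>_def add_nonneg_pos)
  define \<delta> where "\<delta> = \<eta> powr p"
  have \<delta>: "\<delta> > 0" "\<delta> powr (1 / p) = \<eta>" using \<eta> p by (simp_all add: \<delta>_def powr_powr)
  have small: "4 * D * \<delta> powr (1 / p) * measure m UNIV + 8 * D * tail_moment R < e"
  proof -
    have "4 * D * \<eta> * measure m UNIV \<le> 4 * (D + 1) * \<eta> * (measure m UNIV + 1)"
      using D \<eta> by (intro mult_mono) auto
    also have "\<dots> = e / 2"
    proof -
      have "4 * X * (e / (8 * X * Y)) * Y = e / 2" if "X > 0" "Y > 0" for X Y :: real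
        using that by (simp add: field_simps)
      from this[of "D + 1" "measure m UNIV + 1"] show ?thesis
        unfolding \<eta>_def using D measure_nonneg[of m UNIV] by linarith
    qed
    finally have 1: "4 * D * \<eta> * measure m UNIV \<le> e / 2" .
    have "8 * D * tail_moment R \<le> 8 * D * c" using D R by (intro mult_left_mono) auto
    also have "\<dots> < 8 * (D + 1) * c" using c by simp
    also have "\<dots> = e / 2" using D by (simp add: c_def field_simps)
    finally show ?thesis using 1 \<delta>(2) by simp
  qed
  show "\<exists>\<gamma> R. gauge \<gamma> \<and> R > 0 \<and>
      (\<forall>a b \<D>. a < - R \<and> R < b \<and> \<D> tagged_division_of {a..b} \<and> \<gamma> fine \<D> \<longrightarrow>
        norm ((\<Sum>(x, K)\<in>\<D>. (g (Sup K) - g (Inf K)) *\<^sub>R Psi f x)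
          - - (LINT t|lebesgue. f t * fourier_transform g t)) < e)"
  proof (intro exI[of _ "\<lambda>x. ball x \<delta>"] exI[of _ R] conjI allI impI)
    show "gauge (\<lambda>x. ball x \<delta>)" using \<delta> by (rule_tac gauge_ball)
    show "0 < R" using R by simp
    fix a b \<D>
    assume "a < - R \<and> R < b \<and> \<D> tagged_division_of {a..b} \<and> (\<lambda>x. ball x \<delta>) fine \<D>"
    then show "norm ((\<Sum>(x, K)\<in>\<D>. (g (Sup K) - g (Inf K)) *\<^sub>R Psi f x)
        - - (LINT t|lebesgue. f t * fourier_transform g t)) < e"
      using norm_HS_sum_le[of R a b \<delta> \<D>] R \<delta> small by auto
  qed
qed

end

theorem theorem6p1:
  fixes p :: real and q :: ennreal
    and f :: "real \<Rightarrow> complex" and g :: "real \<Rightarrow> real"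
  assumes "1 \<le> p"
    and "1 / ennreal p + 1 / q = 1"
    and "in_Lp (ennreal p) f"
    and "bounded_variation_on g UNIV"
    and "(g \<longlongrightarrow> 0) at_top"
    and "(g \<longlongrightarrow> 0) at_bot"
    and "integrable (variation_measure g) (\<lambda>s. \<bar>s\<bar> powr (1 / p))"
  shows "(\<forall>t. t \<noteq> 0 \<longrightarrow>
            (\<lambda>s. exp (- \<i> * of_real s * of_real t) * of_real (g s) :: complex) integrable_on UNIV)
       \<and> in_Lp q (fourier_transform g)
       \<and> fourier_pairing_defined p f g
       \<and> fourier_pairing f g = (LINT s|lebesgue. f s * fourier_transform g s)
       \<and> norm (fourier_pairing f g)
           \<le> C_const q * Lp_norm p f * (LINT s|variation_measure g. \<bar>s\<bar> powr (1 / p))"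
proof -
  \<comment> \<open>With this \<open>D\<close> the bound \<open>D * moment_integral\<close> is the
    inequality claimed for the pairing.\<close>
  interpret fourier_pairing_setup g p f "C_const q * Lp_norm p f"
  proof
    show "f \<in> borel_measurable lebesgue" using assms(3) by (simp add: in_Lp_def)
    show "0 \<le> C_const q * Lp_norm p f" by (simp add: C_const_nonneg Lp_norm_def)
  qed (use assms nn_integral_mult_fourier_kernel_le in auto)
  have pairing: "fourier_pairing f g = (LINT s|lebesgue. f s * fourier_transform g s)"
    using has_HS_integral_imp_HS_integral_eq[OF has_HS_integral_Psi] by (simp add: fourier_pairing_def)
  have "in_Lp q (fourier_transform g)"
    using assms(1,2)
  proof (cases rule: conjugate_exponent_cases)
    case 1
    then show ?thesis using fourier_transform_in_L_infinity by simp
  next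
    case (2 r)
    then show ?thesis using fourier_transform_in_Lq by simp
  qed
  moreover have "fourier_pairing_defined p f g"
    unfolding fourier_pairing_defined_def using assms(4) g_smallo has_HS_integral_Psi by blast
  ultimately show ?thesis
    using pairing fourier_integrable norm_integral_f_fourier_transform_le
    by (simp add: moment_integral_def)
qed

end
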